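(* Let $\mathfrak g$ be a non-abelian $7$-dimensional real Lie algebra admitting an abelian almost $3$-contact structure $(\varphi_i,\xi_i,\eta_i)$, $i=1,2,3$, with associated endomorphism $\psi:\mathfrak h\to\mathfrak h$ and vector $\mathcal Z\in\mathfrak h$. Then $\psi$ is invertible or $\psi=0$. Moreover: (a) If $\psi$ is invertible, then $\mathfrak g\cong\mathfrak{so}(3)\ltimes\mathbb R^4$, where the $\mathfrak{so}(3)$ factor is $\mathfrak v$, the abelian ideal $\mathbb R^4$ is $\mathfrak h$, and the non-zero brackets are $[\xi_i,\xi_j]=2\delta\xi_k$, $[\xi_i,X]=\delta\varphi_iX$ for every even permutation $(i,j,k)$ of $(1,2,3)$, every $X\in\mathfrak h$, and some real number $\delta\neq0$. (b) If $\psi=0$ and $\mathcal Z=0$, then $\mathfrak g$ is isomorphic to one of the following Lie algebras: $\mathbb R^3\times\mathfrak{aff}(\mathbb C)$, $\mathfrak h_2^{\mathbb R}\times\mathbb R^2$, $\mathfrak h_1^{\mathbb C}\times\mathbb R$, $\mathfrak h_1^{\mathbb H}$, $\mathfrak{so}(3)\times\mathbb R^4$, $\mathfrak{so}(3)\times\mathfrak{aff}(\mathbb C)$. (c) If $\psi=0$ and $\mathcal Z\neq0$, then $\mathfrak g$ is isomorphic to one of the following Lie algebras: $\mathfrak{so}(3)\times\mathbb R^4$ or $\mathfrak n\times\mathbb R$, where $\mathfrak n$ is the free $2$-step nilpotent Lie algebra on $3$ generators.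
   Context: An almost contact structure on a real Lie algebra $\mathfrak g$ is a triple $(\varphi,\xi,\eta)$, $\varphi\in\mathrm{End}(\mathfrak g)$, $\xi\in\mathfrak g$, $\eta\in\mathfrak g^*$, with $\varphi^2=-I+\eta\otimes\xi$ and $\eta(\xi)=1$. It is abelian if $\mathrm{ad}_\xi\circ\varphi=\varphi\circ\mathrm{ad}_\xi$ and $[\varphi X,\varphi Y]=[X,Y]$ for all $X,Y\in\operatorname{Ker}\eta$. An almost $3$-contact structure on a real Lie algebra $\mathfrak g$ of dimension $4n+3$ is given by three almost contact structures $(\varphi_i,\xi_i,\eta_i)$, $i=1,2,3$, such that for every even permutation $(i,j,k)$ of $(1,2,3)$: $\varphi_k=\varphi_i\varphi_j-\eta_j\otimes\xi_i=-\varphi_j\varphi_i+\eta_i\otimes\xi_j$, $\xi_k=\varphi_i\xi_j=-\varphi_j\xi_i$, $\eta_k=\eta_i\circ\varphi_j=-\eta_j\circ\varphi_i$. It is abelian if each $(\varphi_i,\xi_i,\eta_i)$ is abelian. Set $\mathfrak h=\bigcap_{i}\operatorname{Ker}\eta_i$ and $\mathfrak v=\langle\xi_1,\xi_2,\xi_3\rangle$. For an abelian almost $3$-contact structure, $\mathcal Z:=\varphi_i([\xi_j,\xi_k])\in\mathfrak h$ (any even permutation $(i,j,k)$ of $(1,2,3)$) and $\psi:=(\mathrm{ad}_{\xi_i}\circ\varphi_i)|_{\mathfrak h}=(\varphi_i\circ\mathrm{ad}_{\xi_i})|_{\mathfrak h}:\mathfrak h\to\mathfrak h$ (any $i$) are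 well defined. Lie algebras: $\mathfrak{aff}(\mathbb C)$ is the real $4$-dimensional Lie algebra with basis $e_1,\dots,e_4$ and brackets $[e_1,e_3]=e_3$, $[e_1,e_4]=e_4$, $[e_2,e_3]=e_4$, $[e_2,e_4]=-e_3$. $\mathfrak h_2^{\mathbb R}$ is the $5$-dimensional real Heisenberg Lie algebra. $\mathfrak h_1^{\mathbb C}$ is the $3$-dimensional complex Heisenberg Lie algebra viewed as a real Lie algebra of dimension $6$. $\mathfrak h_1^{\mathbb H}$ is the $7$-dimensional (quaternionic Heisenberg) Lie algebra with basis $\xi_1,\xi_2,\xi_3,\tau_1,\tau_2,\tau_3,\tau_4$ and non-zero brackets $[\tau_1,\tau_3]=[\tau_2,\tau_4]=\xi_1$, $[\tau_1,\tau_2]=[\tau_4,\tau_3]=\xi_2$, $[\tau_1,\tau_4]=[\tau_3,\tau_2]=\xi_3$. $\mathbb R^m$ denotes the abelian Lie algebra. *)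

theory Defs
  imports "HOL-Analysis.Analysis"
begin

section \<open>Real Lie algebras\<close>

text \<open>A real Lie algebra is a real vector space, given as a type of class
  \<^class>\<open>real_vector\<close>, together with a bracket on it.\<close>

definition lie_algebra :: "('a::real_vector \<Rightarrow> 'a \<Rightarrow> 'a) \<Rightarrow> bool" where
  "lie_algebra br \<longleftrightarrow> bilinear br \<and> (\<forall>x. br x x = 0) \<and>
     (\<forall>x y z. br x (br y z) + br y (br z x) + br z (br x y) = 0)"

definition abelian_bracket :: "'a::real_vector \<Rightarrow> 'a \<Rightarrow> 'a" where
  "abelian_bracket x y = 0"

definition prod_bracket ::
  "('a::real_vector \<Rightarrow> 'a \<Rightarrow> 'a) \<Rightarrow> ('b::real_vector \<Rightarrow> 'b \<Rightarrow> 'b) \<Rightarrow> 'a \<times> 'b \<Rightarrow> 'a \<times> 'b \<Rightarrow> 'a \<times> 'b" where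
  "prod_bracket br br' p q = (br (fst p) (fst q), br' (snd p) (snd q))"

definition lie_iso_map ::
  "('a::real_vector \<Rightarrow> 'a \<Rightarrow> 'a) \<Rightarrow> ('b::real_vector \<Rightarrow> 'b \<Rightarrow> 'b) \<Rightarrow> ('a \<Rightarrow> 'b) \<Rightarrow> bool" where
  "lie_iso_map br br' f \<longleftrightarrow> linear f \<and> bij f \<and> (\<forall>x y. f (br x y) = br' (f x) (f y))"

definition lie_isomorphic ::
  "('a::real_vector \<Rightarrow> 'a \<Rightarrow> 'a) \<Rightarrow> ('b::real_vector \<Rightarrow> 'b \<Rightarrow> 'b) \<Rightarrow> bool" where
  "lie_isomorphic br br' \<longleftrightarrow> (\<exists>f. lie_iso_map br br' f)"

text \<open>An action of the first Lie algebra on the second: a Lie algebra homomorphism into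
  the derivations of the second.\<close>

definition lie_action ::
  "('a::real_vector \<Rightarrow> 'a \<Rightarrow> 'a) \<Rightarrow> ('b::real_vector \<Rightarrow> 'b \<Rightarrow> 'b) \<Rightarrow> ('a \<Rightarrow> 'b \<Rightarrow> 'b) \<Rightarrow> bool" where
  "lie_action br br' \<rho> \<longleftrightarrow> bilinear \<rho> \<and>
     (\<forall>x u v. \<rho> x (br' u v) = br' (\<rho> x u) v + br' u (\<rho> x v)) \<and>
     (\<forall>x y u. \<rho> (br x y) u = \<rho> x (\<rho> y u) - \<rho> y (\<rho> x u))"

definition semidirect_bracket ::
  "('a::real_vector \<Rightarrow> 'a \<Rightarrow> 'a) \<Rightarrow> ('b::real_vector \<Rightarrow> 'b \<Rightarrow> 'b) \<Rightarrow> ('a \<Rightarrow> 'b \<Rightarrow> 'b) \<Rightarrow>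
   'a \<times> 'b \<Rightarrow> 'a \<times> 'b \<Rightarrow> 'a \<times> 'b" where
  "semidirect_bracket br br' \<rho> p q =
     (br (fst p) (fst q), br' (snd p) (snd q) + \<rho> (fst p) (snd q) - \<rho> (fst q) (snd p))"


section \<open>Almost contact and almost 3-contact structures\<close>

definition almost_contact :: "('a::real_vector \<Rightarrow> 'a) \<Rightarrow> 'a \<Rightarrow> ('a \<Rightarrow> real) \<Rightarrow> bool" where
  "almost_contact \<phi> \<xi> \<eta> \<longleftrightarrow> linear \<phi> \<and> linear \<eta> \<and>
     (\<forall>X. \<phi> (\<phi> X) = - X + \<eta> X *\<^sub>R \<xi>) \<and> \<eta> \<xi> = 1"

definition abelian_almost_contact ::
  "('a::real_vector \<Rightarrow> 'a \<Rightarrow> 'a) \<Rightarrow> ('a \<Rightarrow> 'a) \<Rightarrow> 'a \<Rightarrow> ('a \<Rightarrow> real) \<Rightarrow> bool" where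
  "abelian_almost_contact br \<phi> \<xi> \<eta> \<longleftrightarrow> almost_contact \<phi> \<xi> \<eta> \<and>
     (\<forall>X. br \<xi> (\<phi> X) = \<phi> (br \<xi> X)) \<and>
     (\<forall>X Y. \<eta> X = 0 \<longrightarrow> \<eta> Y = 0 \<longrightarrow> br (\<phi> X) (\<phi> Y) = br X Y)"

text \<open>The three structures are indexed by the three-element type \<^typ>\<open>3\<close>, whose elements are
  \<open>1\<close>, \<open>2\<close> and \<open>3\<close>.\<close>

definition even_perm3 :: "3 \<Rightarrow> 3 \<Rightarrow> 3 \<Rightarrow> bool" where
  "even_perm3 i j k \<longleftrightarrow> (i, j, k) \<in> {(1, 2, 3), (2, 3, 1), (3, 1, 2)}"

definition almost_3_contact ::
  "(3 \<Rightarrow> 'a::real_vector \<Rightarrow> 'a) \<Rightarrow> (3 \<Rightarrow> 'a) \<Rightarrow> (3 \<Rightarrow> 'a \<Rightarrow> real) \<Rightarrow> bool" where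
  "almost_3_contact \<phi> \<xi> \<eta> \<longleftrightarrow>
     (\<exists>n. dim (UNIV :: 'a set) = 4 * n + 3) \<and>
     (\<forall>i. almost_contact (\<phi> i) (\<xi> i) (\<eta> i)) \<and>
     (\<forall>i j k. even_perm3 i j k \<longrightarrow>
        (\<forall>X. \<phi> k X = \<phi> i (\<phi> j X) - \<eta> j X *\<^sub>R \<xi> i) \<and>
        (\<forall>X. \<phi> k X = - \<phi> j (\<phi> i X) + \<eta> i X *\<^sub>R \<xi> j) \<and>
        \<xi> k = \<phi> i (\<xi> j) \<and> \<xi> k = - \<phi> j (\<xi> i) \<and>
        (\<forall>X. \<eta> k X = \<eta> i (\<phi> j X)) \<and> (\<forall>X. \<eta> k X = - \<eta> j (\<phi> i X)))"

definition abelian_almost_3_contact ::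
  "('a::real_vector \<Rightarrow> 'a \<Rightarrow> 'a) \<Rightarrow> (3 \<Rightarrow> 'a \<Rightarrow> 'a) \<Rightarrow> (3 \<Rightarrow> 'a) \<Rightarrow> (3 \<Rightarrow> 'a \<Rightarrow> real) \<Rightarrow> bool" where
  "abelian_almost_3_contact br \<phi> \<xi> \<eta> \<longleftrightarrow> almost_3_contact \<phi> \<xi> \<eta> \<and>
     (\<forall>i. abelian_almost_contact br (\<phi> i) (\<xi> i) (\<eta> i))"

definition horizontal :: "(3 \<Rightarrow> 'a::real_vector \<Rightarrow> real) \<Rightarrow> 'a set" where
  "horizontal \<eta> = (\<Inter>i. {X. \<eta> i X = 0})"

definition vertical :: "(3 \<Rightarrow> 'a::real_vector) \<Rightarrow> 'a set" where
  "vertical \<xi> = span {\<xi> 1, \<xi> 2, \<xi> 3}"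

text \<open>The choice of indices in the next two definitions is immaterial, see
  \<open>assoc_Z_eq\<close> and \<open>assoc_psi_eq\<close> below. Only the values of \<open>assoc_psi\<close> on the horizontal
  subspace are meaningful.\<close>

definition assoc_Z :: "('a::real_vector \<Rightarrow> 'a \<Rightarrow> 'a) \<Rightarrow> (3 \<Rightarrow> 'a \<Rightarrow> 'a) \<Rightarrow> (3 \<Rightarrow> 'a) \<Rightarrow> 'a" where
  "assoc_Z br \<phi> \<xi> = \<phi> 1 (br (\<xi> 2) (\<xi> 3))"

definition assoc_psi ::
  "('a::real_vector \<Rightarrow> 'a \<Rightarrow> 'a) \<Rightarrow> (3 \<Rightarrow> 'a \<Rightarrow> 'a) \<Rightarrow> (3 \<Rightarrow> 'a) \<Rightarrow> 'a \<Rightarrow> 'a" where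
  "assoc_psi br \<phi> \<xi> X = br (\<xi> 1) (\<phi> 1 X)"

lemma bracket_swap:
  assumes "lie_algebra br"
  shows "br x y = - br y x"
proof -
  have "br (x + y) (x + y) = 0" "br x x = 0" "br y y = 0" "bilinear br"
    using assms unfolding lie_algebra_def by blast+
  then show ?thesis
    by (simp add: bilinear_ladd bilinear_radd eq_neg_iff_add_eq_0 add.commute)
qed

lemma almost_contact_xi:
  assumes "almost_contact \<phi> \<xi> \<eta>"
  shows "\<phi> \<xi> = 0"
proof -
  have lin: "linear \<phi>" and sq: "\<And>X. \<phi> (\<phi> X) = - X + \<eta> X *\<^sub>R \<xi>" and one: "\<eta> \<xi> = 1"
    using assms unfolding almost_contact_def by auto
  have 0: "\<phi> (\<phi> \<xi>) = 0" using sq[of \<xi>] one by simp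
  define c where "c = \<eta> (\<phi> \<xi>)"
  have 1: "\<phi> \<xi> = c *\<^sub>R \<xi>" using sq[of "\<phi> \<xi>"] 0 linear_0[OF lin] by (simp add: c_def)
  have "\<phi> (\<phi> \<xi>) = c *\<^sub>R \<phi> \<xi>" by (metis 1 linear_scale[OF lin])
  then have "c = 0 \<or> \<phi> \<xi> = 0" using 0 by simp
  then show ?thesis using 1 by auto
qed

lemma almost_contact_eta:
  assumes "almost_contact \<phi> \<xi> \<eta>"
  shows "\<eta> (\<phi> X) = 0"
proof -
  have lin: "linear \<phi>" "linear \<eta>" and sq: "\<And>X. \<phi> (\<phi> X) = - X + \<eta> X *\<^sub>R \<xi>" and one: "\<eta> \<xi> = 1"
    using assms unfolding almost_contact_def by auto
  have "\<phi> (\<phi> (\<phi> X)) = - \<phi> X"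
    unfolding sq[of X] by (simp only: linear_add[OF lin(1)] linear_neg[OF lin(1)]
      linear_scale[OF lin(1)] almost_contact_xi[OF assms] scaleR_zero_right add_0_right)
  then have "\<eta> (\<phi> X) *\<^sub>R \<xi> = 0" using sq[of "\<phi> X"] by simp
  moreover have "\<xi> \<noteq> 0" using one linear_0[OF lin(2)] by auto
  ultimately show ?thesis by simp
qed

lemma horizontal_phi:
  assumes "almost_3_contact \<phi> \<xi> \<eta>" "X \<in> horizontal \<eta>"
  shows "\<phi> i X \<in> horizontal \<eta>"
proof -
  have e: "\<eta> k Y = \<eta> i (\<phi> j Y)" "\<eta> k Y = - \<eta> j (\<phi> i Y)" if "even_perm3 i j k" for i j k Y
    using assms(1) that unfolding almost_3_contact_def by blast+
  have d: "\<eta> i (\<phi> i Y) = 0" for i Y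
    using assms(1) almost_contact_eta unfolding almost_3_contact_def by blast
  have h: "\<eta> j X = 0" for j using assms(2) by (auto simp: horizontal_def)
  have "\<eta> j (\<phi> i X) = 0" for j
    using e[of 1 2 3 X] e[of 2 3 1 X] e[of 3 1 2 X] d[of i X] h exhaust_3[of i] exhaust_3[of j]
    by (auto simp: even_perm3_def d)
  then show ?thesis by (simp add: horizontal_def)
qed

lemma well_defined_aux:
  assumes L: "lie_algebra br" and A: "abelian_almost_3_contact br \<phi> \<xi> \<eta>"
    and p: "even_perm3 i j k"
  shows "\<phi> i (br (\<xi> j) (\<xi> k)) \<in> horizontal \<eta>"
    and "\<phi> j (br (\<xi> k) (\<xi> i)) = \<phi> k (br (\<xi> i) (\<xi> j))"
    and "X \<in> horizontal \<eta> \<Longrightarrow> br (\<xi> j) (\<phi> j X) = br (\<xi> k) (\<phi> k X)"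
proof -
  have bil: "bilinear br" using L unfolding lie_algebra_def by blast
  have A3: "almost_3_contact \<phi> \<xi> \<eta>" using A unfolding abelian_almost_3_contact_def by blast
  have ac: "almost_contact (\<phi> i) (\<xi> i) (\<eta> i)" for i
    using A3 unfolding almost_3_contact_def by blast
  have lin: "linear (\<phi> i)" "linear (\<eta> i)" for i
    using ac[of i] unfolding almost_contact_def by blast+
  have ad: "br (\<xi> i) (\<phi> i X) = \<phi> i (br (\<xi> i) X)" for i X
    using A unfolding abelian_almost_3_contact_def abelian_almost_contact_def by blast
  have ab: "br (\<phi> i X) (\<phi> i Y) = br X Y" if "\<eta> i X = 0" "\<eta> i Y = 0" for i X Y
    using A that unfolding abelian_almost_3_contact_def abelian_almost_contact_def by blast
  have pj: "even_perm3 j k i" and pk: "even_perm3 k i j" using p by (auto simp: even_perm3_def)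
  have xi: "\<xi> k = - \<phi> j (\<xi> i)" "\<xi> i = \<phi> j (\<xi> k)" "\<xi> j = \<phi> k (\<xi> i)" "\<xi> j = - \<phi> i (\<xi> k)"
    "\<xi> k = \<phi> i (\<xi> j)" "\<xi> i = - \<phi> k (\<xi> j)"
    using A3 p pj pk unfolding almost_3_contact_def by blast+
  have eta: "\<eta> k Y = \<eta> i (\<phi> j Y)" "\<eta> j Y = - \<eta> i (\<phi> k Y)" "\<eta> k Y = - \<eta> j (\<phi> i Y)"
    "\<eta> j Y = \<eta> k (\<phi> i Y)" for Y
    using A3 p pj pk unfolding almost_3_contact_def by blast+
  have phi: "\<phi> k Y = - \<phi> j (\<phi> i Y) + \<eta> i Y *\<^sub>R \<xi> j" "\<phi> j Y = - \<phi> i (\<phi> k Y) + \<eta> k Y *\<^sub>R \<xi> i" for Y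
    using A3 p pk unfolding almost_3_contact_def by blast+
  have jk: "br (\<xi> j) (\<xi> k) = - \<phi> j (br (\<xi> j) (\<xi> i))" "br (\<xi> k) (\<xi> j) = \<phi> k (br (\<xi> k) (\<xi> i))"
    by (metis ad xi(1) bilinear_rneg[OF bil], metis ad xi(3))
  have "\<eta> j (br (\<xi> j) (\<xi> k)) = 0"
    by (simp add: jk(1) linear_neg[OF lin(2)] almost_contact_eta[OF ac])
  moreover have "\<eta> k (br (\<xi> j) (\<xi> k)) = 0"
    by (subst bracket_swap[OF L]) (simp add: jk(2) linear_neg[OF lin(2)] almost_contact_eta[OF ac])
  ultimately have "\<eta> m (\<phi> i (br (\<xi> j) (\<xi> k))) = 0" if "m = i \<or> m = j \<or> m = k" for m
    using that eta(3,4)[of "br (\<xi> j) (\<xi> k)"] almost_contact_eta[OF ac] by auto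
  moreover have "m = i \<or> m = j \<or> m = k" for m
    using p exhaust_3[of m] by (auto simp: even_perm3_def)
  ultimately show "\<phi> i (br (\<xi> j) (\<xi> k)) \<in> horizontal \<eta>" by (auto simp: horizontal_def)
  have ij: "br (\<xi> i) (\<xi> j) = - \<phi> i (br (\<xi> i) (\<xi> k))"
    by (metis ad xi(4) bilinear_rneg[OF bil])
  then have 0: "\<eta> i (br (\<xi> i) (\<xi> j)) = 0"
    by (simp add: linear_neg[OF lin(2)] almost_contact_eta[OF ac])
  have "br (\<xi> k) (\<xi> i) = - \<phi> i (br (\<xi> i) (\<xi> j))"
    by (subst bracket_swap[OF L]) (metis ad xi(5))
  then show "\<phi> j (br (\<xi> k) (\<xi> i)) = \<phi> k (br (\<xi> i) (\<xi> j))"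
    using phi(1)[of "br (\<xi> i) (\<xi> j)"] 0 by (simp add: linear_neg[OF lin(1)])
  show "br (\<xi> j) (\<phi> j X) = br (\<xi> k) (\<phi> k X)" if X: "X \<in> horizontal \<eta>"
  proof -
    have h: "\<eta> m X = 0" "\<eta> m (\<phi> n X) = 0" for m n
      using X horizontal_phi[OF A3 X] by (auto simp: horizontal_def)
    have ex: "\<eta> i (\<xi> k) = 0"
      by (metis xi(5) almost_contact_eta[OF ac])
    have "br (\<phi> i (\<xi> k)) (\<phi> i (\<phi> k X)) = br (\<xi> k) (\<phi> k X)" using ab ex h by blast
    moreover have "\<phi> i (\<xi> k) = - \<xi> j" "\<phi> i (\<phi> k X) = - \<phi> j X"
      using xi(4) phi(2)[of X] h by simp_all
    ultimately show ?thesis by (simp add: bilinear_lneg[OF bil] bilinear_rneg[OF bil])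
  qed
qed

lemma
  assumes "lie_algebra br" "abelian_almost_3_contact br \<phi> \<xi> \<eta>"
  shows assoc_Z_eq: "even_perm3 i j k \<Longrightarrow> assoc_Z br \<phi> \<xi> = \<phi> i (br (\<xi> j) (\<xi> k))"
    and assoc_Z_horizontal: "assoc_Z br \<phi> \<xi> \<in> horizontal \<eta>"
proof -
  have e: "even_perm3 1 2 3" "even_perm3 2 3 1" "even_perm3 3 1 2" by (auto simp: even_perm3_def)
  note w = well_defined_aux[OF assms]
  show "assoc_Z br \<phi> \<xi> = \<phi> i (br (\<xi> j) (\<xi> k))" if "even_perm3 i j k"
    using that w(2)[OF e(1)] w(2)[OF e(2)] w(2)[OF e(3)] by (auto simp: even_perm3_def assoc_Z_def)
  show "assoc_Z br \<phi> \<xi> \<in> horizontal \<eta>"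
    using w(1)[OF e(1)] by (simp add: assoc_Z_def)
qed

lemma
  assumes "lie_algebra br" "abelian_almost_3_contact br \<phi> \<xi> \<eta>" "X \<in> horizontal \<eta>"
  shows assoc_psi_eq: "assoc_psi br \<phi> \<xi> X = br (\<xi> i) (\<phi> i X)"
      "assoc_psi br \<phi> \<xi> X = \<phi> i (br (\<xi> i) X)"
    and assoc_psi_horizontal: "assoc_psi br \<phi> \<xi> X \<in> horizontal \<eta>"
proof -
  have e: "even_perm3 1 2 3" "even_perm3 2 3 1" "even_perm3 3 1 2" by (auto simp: even_perm3_def)
  note w = well_defined_aux(3)[OF assms(1,2) _ assms(3)]
  have ad: "br (\<xi> i) (\<phi> i X) = \<phi> i (br (\<xi> i) X)" for i
    using assms(2) unfolding abelian_almost_3_contact_def abelian_almost_contact_def by blast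
  show 1: "assoc_psi br \<phi> \<xi> X = br (\<xi> i) (\<phi> i X)" for i
    using w[OF e(1)] w[OF e(2)] w[OF e(3)] exhaust_3[of i] by (auto simp: assoc_psi_def)
  then show 2: "assoc_psi br \<phi> \<xi> X = \<phi> i (br (\<xi> i) X)" for i by (simp add: ad)
  have "\<eta> i (assoc_psi br \<phi> \<xi> X) = 0" for i
    using assms(2) almost_contact_eta[of "\<phi> i" "\<xi> i" "\<eta> i"]
    unfolding 2[of i] abelian_almost_3_contact_def almost_3_contact_def by blast
  then show "assoc_psi br \<phi> \<xi> X \<in> horizontal \<eta>" by (simp add: horizontal_def)
qed


section \<open>The model Lie algebras\<close>

text \<open>A list of triples \<open>(i, j, v)\<close> stands for the brackets \<open>[e\<^sub>i, e\<^sub>j] = v = - [e\<^sub>j, e\<^sub>i]\<close>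
  of the standard basis vectors; all brackets not listed are zero.\<close>

definition table_bracket ::
  "('n \<times> 'n \<times> (('k::comm_ring_1)^'n)) list \<Rightarrow> 'k^'n \<Rightarrow> 'k^'n \<Rightarrow> 'k^'n" where
  "table_bracket T x y = (\<Sum>(i, j, v)\<leftarrow>T. (x $ i * y $ j - x $ j * y $ i) *s v)"

definition aff_C_bracket :: "real^4 \<Rightarrow> real^4 \<Rightarrow> real^4" where
  "aff_C_bracket = table_bracket
     [(1, 3, axis 3 1), (1, 4, axis 4 1), (2, 3, axis 4 1), (2, 4, - axis 3 1)]"

text \<open>\<open>\<h>\<^sub>2\<^sup>\<real>\<close>, with basis \<open>x\<^sub>1, y\<^sub>1, x\<^sub>2, y\<^sub>2, z\<close> and brackets \<open>[x\<^sub>i, y\<^sub>i] = z\<close>.\<close>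

definition heis5_bracket :: "real^5 \<Rightarrow> real^5 \<Rightarrow> real^5" where
  "heis5_bracket = table_bracket [(1, 2, axis 5 1), (3, 4, axis 5 1)]"

text \<open>\<open>\<h>\<^sub>1\<^sup>\<complex>\<close>: the table bracket is complex bilinear, and \<^typ>\<open>complex^3\<close> is regarded as a
  real vector space.\<close>

definition heis3_C_bracket :: "complex^3 \<Rightarrow> complex^3 \<Rightarrow> complex^3" where
  "heis3_C_bracket = table_bracket [(1, 2, axis 3 1)]"

text \<open>\<open>\<h>\<^sub>1\<^sup>\<bbbH>\<close>, with basis \<open>\<xi>\<^sub>1, \<xi>\<^sub>2, \<xi>\<^sub>3, \<tau>\<^sub>1, \<tau>\<^sub>2, \<tau>\<^sub>3, \<tau>\<^sub>4\<close> in this order.\<close>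

definition heis7_H_bracket :: "real^7 \<Rightarrow> real^7 \<Rightarrow> real^7" where
  "heis7_H_bracket = table_bracket
     [(4, 6, axis 1 1), (5, 7, axis 1 1),
      (4, 5, axis 2 1), (7, 6, axis 2 1),
      (4, 7, axis 3 1), (6, 5, axis 3 1)]"

text \<open>The free 2-step nilpotent Lie algebra on the generators \<open>e\<^sub>1, e\<^sub>2, e\<^sub>3\<close>, with
  \<open>e\<^sub>4 = [e\<^sub>1, e\<^sub>2]\<close>, \<open>e\<^sub>5 = [e\<^sub>1, e\<^sub>3]\<close>, \<open>e\<^sub>6 = [e\<^sub>2, e\<^sub>3]\<close>. Its universal property is
  \<open>free_nil2_universal\<close> below.\<close>

definition free_nil2_bracket :: "real^6 \<Rightarrow> real^6 \<Rightarrow> real^6" where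
  "free_nil2_bracket = table_bracket [(1, 2, axis 4 1), (1, 3, axis 5 1), (2, 3, axis 6 1)]"

lemma transpose_arith:
  "transpose (0 :: real^'n^'n) = 0" "transpose (A + B) = transpose A + transpose (B :: real^'n^'n)"
  "transpose (A - B) = transpose A - transpose (B :: real^'n^'n)"
  "transpose (- A) = - transpose (A :: real^'n^'n)"
  "transpose (c *\<^sub>R A) = c *\<^sub>R transpose (A :: real^'n^'n)"
  by (simp_all add: transpose_def vec_eq_iff)

text \<open>\<open>\<ss>\<oo>(3)\<close>: skew-symmetric real \<open>3 \<times> 3\<close> matrices with the commutator.\<close>

typedef so3 = "{A :: real^3^3. transpose A = - A}"
  morphisms mat_of_so3 so3_of_mat
  by (rule exI[of _ 0]) (simp add: transpose_arith)

setup_lifting type_definition_so3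

instantiation so3 :: real_vector
begin

lift_definition zero_so3 :: so3 is 0 by (simp add: transpose_arith)
lift_definition plus_so3 :: "so3 \<Rightarrow> so3 \<Rightarrow> so3" is "(+)" by (simp add: transpose_arith)
lift_definition minus_so3 :: "so3 \<Rightarrow> so3 \<Rightarrow> so3" is "(-)" by (simp add: transpose_arith)
lift_definition uminus_so3 :: "so3 \<Rightarrow> so3" is uminus by (simp add: transpose_arith)
lift_definition scaleR_so3 :: "real \<Rightarrow> so3 \<Rightarrow> so3" is scaleR by (simp add: transpose_arith)

instance
  by standard (transfer; simp add: algebra_simps)+

end

lemma matrix_neg_neg: "(- A) ** (- B) = A ** (B :: real^'n^'n)"
  by (simp add: matrix_matrix_mult_def vec_eq_iff)

lift_definition so3_bracket :: "so3 \<Rightarrow> so3 \<Rightarrow> so3" is "\<lambda>A B. A ** B - B ** A"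
  by (simp add: transpose_arith matrix_transpose_mul matrix_neg_neg)


section \<open>Consistency of the definitions\<close>

lemma lie_algebra_prod:
  assumes "lie_algebra br" "lie_algebra br'"
  shows "lie_algebra (prod_bracket br br')"
  using assms unfolding lie_algebra_def bilinear_def linear_iff
  by (simp add: prod_bracket_def plus_prod_def zero_prod_def)

lemma lie_algebra_semidirect:
  assumes "lie_algebra br" "lie_algebra br'" "lie_action br br' \<rho>"
  shows "lie_algebra (semidirect_bracket br br' \<rho>)"
proof -
  note swap = bracket_swap[OF assms(1)] bracket_swap[OF assms(2)]
  have b: "bilinear br" "bilinear br'" "bilinear \<rho>"
    and J: "\<And>x y z. br' x (br' y z) + br' y (br' z x) + br' z (br' x y) = 0"
    and D: "\<And>x u v. \<rho> x (br' u v) = br' (\<rho> x u) v + br' u (\<rho> x v)"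
    and H: "\<And>x y u. \<rho> (br x y) u = \<rho> x (\<rho> y u) - \<rho> y (\<rho> x u)"
    using assms unfolding lie_algebra_def lie_action_def by blast+
  note bl = bilinear_ladd[OF b(1)] bilinear_radd[OF b(1)] bilinear_lmul[OF b(1)] bilinear_rmul[OF b(1)]
    bilinear_ladd[OF b(2)] bilinear_radd[OF b(2)] bilinear_lmul[OF b(2)] bilinear_rmul[OF b(2)]
    bilinear_lsub[OF b(2)] bilinear_rsub[OF b(2)]
    bilinear_ladd[OF b(3)] bilinear_radd[OF b(3)] bilinear_lmul[OF b(3)] bilinear_rmul[OF b(3)]
    bilinear_rsub[OF b(3)]
  have sw: "br' u (\<rho> y w) = - br' (\<rho> y w) u" for u y w using swap(2) .
  have "bilinear (semidirect_bracket br br' \<rho>)"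
    unfolding bilinear_def linear_iff semidirect_bracket_def
    by (simp add: bl algebra_simps scaleR_diff_right)
  moreover have "semidirect_bracket br br' \<rho> p p = 0" for p
    using assms(1,2) by (simp add: semidirect_bracket_def lie_algebra_def zero_prod_def)
  moreover have "br' u (br' v w + \<rho> y w - \<rho> z v) + \<rho> x (br' v w + \<rho> y w - \<rho> z v) - \<rho> (br y z) u
      + (br' v (br' w u + \<rho> z u - \<rho> x w) + \<rho> y (br' w u + \<rho> z u - \<rho> x w) - \<rho> (br z x) v)
      + (br' w (br' u v + \<rho> x v - \<rho> y u) + \<rho> z (br' u v + \<rho> x v - \<rho> y u) - \<rho> (br x y) w) = 0"
    for x y z u v w
    using J[of u v w] by (simp add: bl D H sw algebra_simps)
  ultimately show ?thesis
    using assms(1) unfolding lie_algebra_def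
    by (simp add: semidirect_bracket_def zero_prod_def)
qed

lemma table_bracket_simps:
  "table_bracket [] x y = 0"
  "table_bracket ((i, j, v) # T) x y = (x $ i * y $ j - x $ j * y $ i) *s v + table_bracket T x y"
  by (simp_all add: table_bracket_def)

lemma table_bracket_alternating: "table_bracket T x x = 0"
  by (induction T) (auto simp: table_bracket_simps mult.commute)

lemma bilinear_table_bracket:
  "bilinear (table_bracket T :: ('k::{comm_ring_1, real_algebra_1})^'n \<Rightarrow> _)"
proof (induction T)
  case Nil
  show ?case by (simp add: bilinear_def linear_iff table_bracket_simps)
next
  case (Cons t T)
  obtain i j v where t: "t = (i, j, v)" by (cases t)
  show ?case
    using Cons unfolding t bilinear_def linear_iff table_bracket_simps
    by (simp add: vec_eq_iff algebra_simps)
qed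

lemma lie_algebra_table_bracket:
  fixes T :: "('n::finite \<times> 'n \<times> (('k::{comm_ring_1, real_algebra_1})^'n)) list"
  assumes "\<And>x y z. table_bracket T x (table_bracket T y z) + table_bracket T y (table_bracket T z x)
             + table_bracket T z (table_bracket T x y) = 0"
  shows "lie_algebra (table_bracket T)"
  using assms bilinear_table_bracket[of T] table_bracket_alternating[of T]
  unfolding lie_algebra_def by blast

lemma lie_algebra_abelian: "lie_algebra abelian_bracket"
  by (simp add: lie_algebra_def abelian_bracket_def bilinear_def linear_iff)

lemma lie_algebra_aff_C: "lie_algebra aff_C_bracket"
  unfolding aff_C_bracket_def
  by (rule lie_algebra_table_bracket)
     (simp add: table_bracket_simps axis_def vec_eq_iff forall_4 algebra_simps)

lemma lie_algebra_heis5: "lie_algebra heis5_bracket"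
  unfolding heis5_bracket_def
  by (rule lie_algebra_table_bracket) (simp add: table_bracket_simps axis_def vec_eq_iff)

lemma lie_algebra_heis3_C: "lie_algebra heis3_C_bracket"
  unfolding heis3_C_bracket_def
  by (rule lie_algebra_table_bracket) (simp add: table_bracket_simps axis_def vec_eq_iff)

lemma lie_algebra_heis7_H: "lie_algebra heis7_H_bracket"
  unfolding heis7_H_bracket_def
  by (rule lie_algebra_table_bracket) (simp add: table_bracket_simps axis_def vec_eq_iff)

lemma lie_algebra_free_nil2: "lie_algebra free_nil2_bracket"
  unfolding free_nil2_bracket_def
  by (rule lie_algebra_table_bracket) (simp add: table_bracket_simps axis_def vec_eq_iff)

lemma lie_algebra_so3: "lie_algebra so3_bracket"
proof -
  have d: "(A + B) ** C = A ** C + B ** C" "(A - B) ** C = A ** C - B ** C"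
    "C ** (A - B) = C ** A - C ** B" "(c *\<^sub>R A) ** C = c *\<^sub>R (A ** C)"
    "C ** (c *\<^sub>R A) = c *\<^sub>R (C ** A)" for A B C :: "real^3^3" and c
    by (simp_all add: matrix_matrix_mult_def vec_eq_iff algebra_simps sum.distrib
        sum_subtractf sum_distrib_left)
  have "so3_bracket (x + y) z = so3_bracket x z + so3_bracket y z"
    "so3_bracket z (x + y) = so3_bracket z x + so3_bracket z y"
    "so3_bracket (c *\<^sub>R x) z = c *\<^sub>R so3_bracket x z"
    "so3_bracket z (c *\<^sub>R x) = c *\<^sub>R so3_bracket z x"
    "so3_bracket x x = 0" for x y z c
    by (transfer; simp add: d matrix_add_ldistrib scaleR_diff_right)+
  moreover have "so3_bracket x (so3_bracket y z) + so3_bracket y (so3_bracket z x)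
      + so3_bracket z (so3_bracket x y) = 0" for x y z
    by transfer (simp add: d matrix_mul_assoc)
  ultimately show ?thesis unfolding lie_algebra_def bilinear_def linear_iff by blast
qed

lemma exhaust_6: "(i::6) \<in> {1, 2, 3, 4, 5, 6}"
proof (induct i)
  case (of_int z)
  then have "z \<in> {0, 1, 2, 3, 4, 5}" by auto
  then show ?case by auto
qed

lemma all_6: "(\<forall>i::6. P i) \<longleftrightarrow> P 1 \<and> P 2 \<and> P 3 \<and> P 4 \<and> P 5 \<and> P 6"
  using exhaust_6 by (metis insertE singletonD)

lemma free_nil2_nilpotent: "free_nil2_bracket (free_nil2_bracket x y) z = 0"
  by (simp add: free_nil2_bracket_def table_bracket_simps axis_def vec_eq_iff all_6)

lemma free_nil2_universal:
  fixes br :: "'a::real_vector \<Rightarrow> 'a \<Rightarrow> 'a"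
  assumes L: "lie_algebra br" and N: "\<And>x y z. br (br x y) z = 0"
  shows "\<exists>!f. linear f \<and> (\<forall>x y. f (free_nil2_bracket x y) = br (f x) (f y)) \<and>
           f (axis 1 1) = a \<and> f (axis 2 1) = b \<and> f (axis 3 1) = c"
proof -
  have bil: "bilinear br" and alt: "\<And>x. br x x = 0" using L unfolding lie_algebra_def by blast+
  note bl = bilinear_ladd[OF bil] bilinear_radd[OF bil] bilinear_lmul[OF bil] bilinear_rmul[OF bil]
    bilinear_lzero[OF bil] bilinear_rzero[OF bil]
  have N': "br z (br x y) = 0" for x y z using bracket_swap[OF L, of z] N by simp
  define f where "f x = x $ 1 *\<^sub>R a + x $ 2 *\<^sub>R b + x $ 3 *\<^sub>R c + x $ 4 *\<^sub>R br a b
      + x $ 5 *\<^sub>R br a c + x $ 6 *\<^sub>R br b c" for x :: "real^6"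
  have sw: "br b a = - br a b" "br c a = - br a c" "br c b = - br b c"
    using bracket_swap[OF L] by blast+
  have 1: "linear f" unfolding linear_iff f_def by (simp add: algebra_simps)
  have 2: "f (free_nil2_bracket x y) = br (f x) (f y)" for x y
    unfolding f_def
    by (simp add: bl N N' alt sw free_nil2_bracket_def table_bracket_simps axis_def algebra_simps)
  have 3: "f (axis 1 1) = a \<and> f (axis 2 1) = b \<and> f (axis 3 1) = c"
    by (simp add: f_def axis_def)
  have 4: "g = f" if g: "linear g" "\<forall>x y. g (free_nil2_bracket x y) = br (g x) (g y)"
    "g (axis 1 1) = a" "g (axis 2 1) = b" "g (axis 3 1) = c" for g
  proof
    fix x :: "real^6"
    have t: "axis 4 1 = free_nil2_bracket (axis 1 1) (axis 2 1)"
      "axis 5 1 = free_nil2_bracket (axis 1 1) (axis 3 1)"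
      "axis 6 1 = free_nil2_bracket (axis 2 1) (axis 3 1)"
      by (simp_all add: free_nil2_bracket_def table_bracket_simps axis_def vec_eq_iff all_6)
    have x: "x = x $ 1 *\<^sub>R axis 1 1 + x $ 2 *\<^sub>R axis 2 1 + x $ 3 *\<^sub>R axis 3 1 + x $ 4 *\<^sub>R axis 4 1
      + x $ 5 *\<^sub>R axis 5 1 + x $ 6 *\<^sub>R axis 6 1"
      by (simp add: vec_eq_iff all_6 axis_def)
    show "g x = f x"
      by (subst x) (simp add: linear_add[OF g(1)] linear_scale[OF g(1)] f_def t g(2-5))
  qed
  show ?thesis using 1 2 3 4 by (intro ex1I[of _ f]) blast+
qed

end

theory Submission
  imports Defs
begin

text \<open>Fix a nonzero \<open>X\<close> in \<open>\<h>\<close>; then \<open>X, \<phi>\<^sub>1 X, \<phi>\<^sub>2 X, \<phi>\<^sub>3 X\<close> is a basis of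
  \<open>\<h>\<close>. Since \<open>\<psi>\<close> commutes with the \<open>\<phi>\<^sub>i\<close>, it is zero or invertible. The Jacobi
  identity gives \<open>\<psi> Z = 0\<close> and \<open>[\<phi>\<^sub>i Z, X] = - 2 \<phi>\<^sub>i (\<psi>\<^sup>2 + \<delta> \<psi>) X\<close>, where
  \<open>[\<xi>\<^sub>i, \<xi>\<^sub>j] = 2\<delta> \<xi>\<^sub>k - \<phi>\<^sub>k Z\<close>. If \<open>\<psi>\<close> is invertible, then \<open>Z = 0\<close> and
  \<open>\<psi> = - \<delta>\<close>. If \<open>\<psi> = 0\<close> and \<open>Z \<noteq> 0\<close>, then \<open>\<h>\<close> is central and only the
  brackets of the \<open>\<xi>\<^sub>i\<close> survive. If \<open>\<psi> = 0\<close> and \<open>Z = 0\<close>, then the brackets of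
  \<open>\<h>\<close> are determined by the linear map \<open>u a = [X, \<Sum>\<^sub>i a\<^sub>i \<phi>\<^sub>i X]\<close> on \<open>\<real>\<^sup>3\<close>, because
  \<open>[\<phi>\<^sub>i X, \<phi>\<^sub>j X] = - [X, \<phi>\<^sub>k X]\<close>: if \<open>u\<close> takes a value outside \<open>\<v>\<close>, then a suitable
  rotation of the structure exhibits \<open>\<aa>\<ff>\<ff>(\<complex>)\<close>; if all values are in \<open>\<v>\<close>, then either
  \<open>\<v> \<cong> \<ss>\<oo>(3)\<close> and \<open>u = 0\<close>, or the algebra is 2-step nilpotent and determined by the rank of
  \<open>u\<close>.\<close>

section \<open>Constructing isomorphisms\<close>

lemma lie_iso_map_inv:
  assumes "lie_iso_map br br' f"
  shows "lie_iso_map br' br (inv f)"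
proof -
  have f: "linear f" "bij f" "\<And>x y. f (br x y) = br' (f x) (f y)"
    using assms unfolding lie_iso_map_def by blast+
  have "linear (inv f)"
    by (rule linearI; rule injD[OF bij_is_inj[OF f(2)]])
       (simp_all add: linear_add[OF f(1)] linear_scale[OF f(1)] surj_f_inv_f[OF bij_is_surj[OF f(2)]])
  moreover have "inv f (br' x y) = br (inv f x) (inv f y)" for x y
    by (rule injD[OF bij_is_inj[OF f(2)]]) (simp add: f(3) surj_f_inv_f[OF bij_is_surj[OF f(2)]])
  ultimately show ?thesis
    using f(2) by (simp add: lie_iso_map_def bij_imp_bij_inv)
qed

lemma lie_isomorphic_sym: "lie_isomorphic br br' \<Longrightarrow> lie_isomorphic br' br"
  unfolding lie_isomorphic_def using lie_iso_map_inv by blast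

lemma lie_isomorphic_trans:
  assumes "lie_isomorphic br br'" "lie_isomorphic br' br''"
  shows "lie_isomorphic br br''"
proof -
  obtain f g where f: "lie_iso_map br br' f" and g: "lie_iso_map br' br'' g"
    using assms unfolding lie_isomorphic_def by blast
  have "lie_iso_map br br'' (g \<circ> f)"
    using f g unfolding lie_iso_map_def by (simp add: linear_compose bij_comp)
  then show ?thesis unfolding lie_isomorphic_def by blast
qed

lemma lie_isomorphic_prod_cong_left:
  assumes "lie_isomorphic br br'"
  shows "lie_isomorphic (prod_bracket br br'') (prod_bracket br' br'')"
proof -
  obtain f where f: "linear f" "bij f" "\<And>x y. f (br x y) = br' (f x) (f y)"
    using assms unfolding lie_isomorphic_def lie_iso_map_def by blast
  have "linear (map_prod f id)"
    by (rule linearI) (auto simp: linear_add[OF f(1)] linear_scale[OF f(1)])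
  moreover have "bij (map_prod f id)"
    using f(2) by (simp add: bij_betw_def prod.inj_map map_prod_surj)
  ultimately have "lie_iso_map (prod_bracket br br'') (prod_bracket br' br'') (map_prod f id)"
    by (simp add: lie_iso_map_def prod_bracket_def f(3))
  then show ?thesis unfolding lie_isomorphic_def by blast
qed

text \<open>A basis extracted from the image of the standard basis must have as many elements as the
  standard basis itself. So nothing is discarded or identified, and an independent image of a basis
  makes \<open>g\<close> injective.\<close>

lemma linear_surj_imp_bij:
  fixes g :: "'b::euclidean_space \<Rightarrow> 'a::real_vector"
  assumes g: "linear g" "surj g" and d: "DIM('b) = dim (UNIV :: 'a set)"
  shows "bij g"
proof -
  have sp: "span (g ` Basis) = UNIV"
    by (simp add: linear_span_image[OF g(1)] g(2))
  obtain B where B: "B \<subseteq> g ` Basis" "independent B" "g ` Basis \<subseteq> span B"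
    using maximal_independent_subset by blast
  have "span B = UNIV" using sp B(3) span_minimal[OF B(3) subspace_span] by auto
  then have "card B = DIM('b)" using d B(2) by (metis basis_card_eq_dim subset_UNIV top_greatest)
  then have c: "DIM('b) \<le> card (g ` Basis)" by (metis B(1) card_mono finite_Basis finite_imageI)
  then have "B = g ` Basis"
    using B(1) \<open>card B = DIM('b)\<close> by (metis card_image_le card_seteq finite_Basis finite_imageI le_antisym)
  then have i: "independent (g ` Basis)" using B(2) by simp
  have "inj_on g Basis" using c by (simp add: card_image_le eq_card_imp_inj_on le_antisym)
  then have "inj_on g (span Basis)"
    using linear_inj_on_span_independent_image[OF g(1) i] by blast
  then show ?thesis using g(2) by (simp add: bij_def)
qed

text \<open>The image of the standard basis is independent; extending it to a basis adds nothing
  because the cardinalities already agree.\<close>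

lemma linear_inj_imp_surj_dim:
  fixes g :: "'b::euclidean_space \<Rightarrow> 'a::real_vector"
  assumes g: "linear g" "inj g" and d: "DIM('b) = dim (UNIV :: 'a set)"
  shows "surj g"
proof -
  have i: "independent (g ` Basis)"
    using linear_independent_injective_image[OF g(1) independent_Basis g(2)[THEN inj_on_subset]] by simp
  have ci: "card (g ` Basis) = DIM('b)" using g(2) by (simp add: card_image inj_on_subset)
  obtain C where C: "g ` Basis \<subseteq> C" "independent C" "span C = (UNIV :: 'a set)"
    using maximal_independent_subset_extend[OF subset_UNIV i] by (metis UNIV_eq_I subsetD UNIV_I)
  have "card C = DIM('b)" using d C(2,3) by (metis basis_card_eq_dim subset_UNIV top_greatest)
  \<comment> \<open>An infinite \<open>C\<close> would have \<open>card\<close> equal to 0, which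
    the positive dimension excludes.\<close>
  then have "g ` Basis = C"
    using C(1) ci card_subset_eq[of C "g ` Basis"] by (metis DIM_positive card.infinite less_irrefl)
  then have "span (g ` Basis) = UNIV" using C(3) by simp
  then show ?thesis by (simp add: linear_span_image[OF g(1)])
qed

text \<open>The map runs from the model, where coordinates are explicit, into the given algebra;
  equality of dimensions turns surjectivity into bijectivity.\<close>

lemma lie_isomorphicI:
  fixes g :: "'b::euclidean_space \<Rightarrow> 'a::real_vector"
  assumes "linear g" "surj g" "DIM('b) = dim (UNIV :: 'a set)"
    and "\<And>x y. g (br' x y) = br (g x) (g y)"
  shows "lie_isomorphic br br'"
proof -
  have "lie_iso_map br' br g"
    using assms linear_surj_imp_bij[OF assms(1-3)] by (simp add: lie_iso_map_def)
  then show ?thesis using lie_isomorphic_sym unfolding lie_isomorphic_def by blast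
qed

text \<open>The two images commute, so mixed brackets vanish and the sum map respects the product
  bracket; the dimension count makes the sum direct.\<close>

lemma lie_isomorphic_prodI:
  fixes g1 :: "'b::euclidean_space \<Rightarrow> 'a::real_vector" and g2 :: "'c::euclidean_space \<Rightarrow> 'a"
  assumes L: "lie_algebra br"
    and d: "DIM('b) + DIM('c) = dim (UNIV :: 'a set)"
    and g: "linear g1" "linear g2"
    and h: "\<And>x y. g1 (br1 x y) = br (g1 x) (g1 y)" "\<And>x y. g2 (br2 x y) = br (g2 x) (g2 y)"
    and c: "\<And>x y. br (g1 x) (g2 y) = 0"
    and s: "\<And>Y. \<exists>x y. Y = g1 x + g2 y"
  shows "lie_isomorphic br (prod_bracket br1 br2)"
proof (rule lie_isomorphicI)
  let ?g = "\<lambda>p. g1 (fst p) + g2 (snd p)"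
  have bil: "bilinear br" using L by (simp add: lie_algebra_def)
  show "linear ?g"
    by (rule linearI)
       (auto simp: linear_add[OF g(1)] linear_add[OF g(2)] linear_scale[OF g(1)] linear_scale[OF g(2)]
          algebra_simps)
  show "surj ?g"
  proof (unfold surj_def, rule allI)
    fix Y obtain x y where "Y = g1 x + g2 y" using s by blast
    then show "\<exists>p. Y = g1 (fst p) + g2 (snd p)" by (intro exI[of _ "(x, y)"]) simp
  qed
  show "DIM('b \<times> 'c) = dim (UNIV :: 'a set)" using d by simp
  have c': "br (g2 y) (g1 x) = 0" for x y using bracket_swap[OF L, of "g2 y"] c by simp
  show "?g (prod_bracket br1 br2 p q) = br (?g p) (?g q)" for p q
    by (simp add: prod_bracket_def h bilinear_ladd[OF bil] bilinear_radd[OF bil] c c')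
qed

section \<open>The Lie algebra so(3) as three-space with the cross product\<close>

definition axial :: "so3 \<Rightarrow> real^3" where
  "axial A = vector [mat_of_so3 A $ 3 $ 2, mat_of_so3 A $ 1 $ 3, mat_of_so3 A $ 2 $ 1]"

text \<open>A skew-symmetric matrix is the matrix of x |-> a x x (cross product) for a unique vector
  a, and \<open>axial\<close> returns this a. Commutators then become cross products.\<close>

lemma axial_iso: "lie_iso_map so3_bracket cross3 axial"
proof -
  have sk: "mat_of_so3 A $ i $ j = - mat_of_so3 A $ j $ i" for A i j
  proof -
    have "transpose (mat_of_so3 A) = - mat_of_so3 A" using mat_of_so3[of A] by blast
    from arg_cong[OF this, of "\<lambda>M. M $ j $ i"] show ?thesis by (simp add: transpose_def)
  qed
  have dg: "mat_of_so3 A $ i $ i = 0" for A i using sk[of A i i] by linarith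
  have "linear axial"
    by (rule linearI) (simp_all add: axial_def plus_so3.rep_eq scaleR_so3.rep_eq vec_eq_iff forall_3)
  moreover have "inj axial"
  proof (rule injI)
    fix A B assume "axial A = axial B"
    then have "mat_of_so3 A $ 3 $ 2 = mat_of_so3 B $ 3 $ 2" "mat_of_so3 A $ 1 $ 3 = mat_of_so3 B $ 1 $ 3"
       "mat_of_so3 A $ 2 $ 1 = mat_of_so3 B $ 2 $ 1"
      by (simp_all add: axial_def vec_eq_iff forall_3)
    then have "mat_of_so3 A = mat_of_so3 B"
      using sk[of A 2 3] sk[of A 3 1] sk[of A 1 2] sk[of B 2 3] sk[of B 3 1] sk[of B 1 2]
      by (simp add: vec_eq_iff forall_3 dg)
    then show "A = B" by (simp add: mat_of_so3_inject)
  qed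
  moreover have "surj axial"
  proof (unfold surj_def, rule allI)
    fix a :: "real^3"
    define M :: "real^3^3" where
      "M = vector [vector [0, - a$3, a$2], vector [a$3, 0, - a$1], vector [- a$2, a$1, 0]]"
    have "transpose M = - M" by (simp add: M_def transpose_def vec_eq_iff forall_3)
    then have "axial (so3_of_mat M) = a"
      by (simp add: axial_def so3_of_mat_inverse) (simp add: M_def vec_eq_iff forall_3)
    then show "\<exists>A. a = axial A" by metis
  qed
  moreover have "axial (so3_bracket A B) = cross3 (axial A) (axial B)" for A B
    using sk[of A 2 3] sk[of A 3 1] sk[of A 1 2] sk[of B 2 3] sk[of B 3 1] sk[of B 1 2]
    by (simp add: axial_def so3_bracket.rep_eq vec_eq_iff forall_3 cross_components
        matrix_matrix_mult_def sum_3 dg)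
  ultimately show ?thesis by (simp add: lie_iso_map_def bij_def)
qed

lemma cross3_iso_so3: "lie_isomorphic cross3 so3_bracket"
  using axial_iso lie_isomorphic_sym unfolding lie_isomorphic_def by blast

text \<open>A basis \<open>\<xi>\<^sub>1, \<xi>\<^sub>2, \<xi>\<^sub>3\<close> with \<open>[\<xi>\<^sub>i, \<xi>\<^sub>j] = 2\<delta> \<xi>\<^sub>k\<close>, rescaled by \<open>1 / (2\<delta>)\<close>,
  obeys the rules of the cross product.\<close>

lemma lie_isomorphic_so3_prodI:
  fixes v :: "real^3 \<Rightarrow> 'a::real_vector" and g :: "'c::euclidean_space \<Rightarrow> 'a"
  assumes L: "lie_algebra br"
    and d: "3 + DIM('c) = dim (UNIV :: 'a set)"
    and lin: "linear v" "linear g"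
    and v: "\<And>a b. br (v a) (v b) = (2 * \<delta>) *\<^sub>R v (cross3 a b)"
    and g: "\<And>x y. g (br2 x y) = br (g x) (g y)"
    and c: "\<And>x y. br (v x) (g y) = 0"
    and s: "\<And>Y. \<exists>x y. Y = v x + g y"
    and \<delta>: "\<delta> \<noteq> 0"
  shows "lie_isomorphic br (prod_bracket so3_bracket br2)"
proof (rule lie_isomorphic_trans)
  have bil: "bilinear br" using L by (simp add: lie_algebra_def)
  let ?v = "\<lambda>x. v ((1 / (2 * \<delta>)) *\<^sub>R x)"
  show "lie_isomorphic br (prod_bracket cross3 br2)"
  proof (rule lie_isomorphic_prodI[OF L, of ?v g])
    show "linear ?v" by (rule linearI) (simp_all add: linear_add[OF lin(1)] linear_scale[OF lin(1)] algebra_simps)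
    show "?v (cross3 x y) = br (?v x) (?v y)" for x y
      using \<delta> by (simp add: v cross_mult_left cross_mult_right linear_scale[OF lin(1)]
          bilinear_lmul[OF bil] bilinear_rmul[OF bil])
    show "\<exists>x y. Y = ?v x + g y" for Y
    proof -
      obtain x y where "Y = v x + g y" using s by blast
      then have "Y = ?v ((2 * \<delta>) *\<^sub>R x) + g y" using \<delta> by simp
      then show ?thesis by blast
    qed
  qed (use lin g c d in auto)
  show "lie_isomorphic (prod_bracket cross3 br2) (prod_bracket so3_bracket br2)"
    by (rule lie_isomorphic_prod_cong_left[OF cross3_iso_so3])
qed

section \<open>Structure equations\<close>

locale abelian_3_contact =
  fixes br :: "'a::real_vector \<Rightarrow> 'a \<Rightarrow> 'a"
    and \<phi> :: "3 \<Rightarrow> 'a \<Rightarrow> 'a" and \<xi> :: "3 \<Rightarrow> 'a" and \<eta> :: "3 \<Rightarrow> 'a \<Rightarrow> real"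
  assumes lie: "lie_algebra br"
    and contact: "abelian_almost_3_contact br \<phi> \<xi> \<eta>"
begin

abbreviation "H \<equiv> horizontal \<eta>"
abbreviation "\<psi> \<equiv> assoc_psi br \<phi> \<xi>"
abbreviation "Z \<equiv> assoc_Z br \<phi> \<xi>"

section \<open>Elementary identities of the structure\<close>

lemma bil: "bilinear br"
  using lie by (simp add: lie_algebra_def)

lemma alt: "br x x = 0"
  using lie by (simp add: lie_algebra_def)

lemmas bl = bilinear_ladd[OF bil] bilinear_radd[OF bil] bilinear_lmul[OF bil] bilinear_rmul[OF bil]
  bilinear_lneg[OF bil] bilinear_rneg[OF bil] bilinear_lsub[OF bil] bilinear_rsub[OF bil]
  bilinear_lzero[OF bil] bilinear_rzero[OF bil]

lemma swap: "br x y = - br y x"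
  by (rule bracket_swap[OF lie])

lemma jacobi: "br x (br y z) = br (br x y) z + br y (br x z)"
proof -
  have "br x (br y z) + br y (br z x) + br z (br x y) = 0"
    using lie unfolding lie_algebra_def by blast
  moreover have "br y (br z x) = - br y (br x z)" "br z (br x y) = - br (br x y) z"
    using swap[of z x] swap[of z "br x y"] by (simp_all add: bl)
  ultimately show ?thesis by (simp add: algebra_simps add_eq_0_iff)
qed

lemma contact3: "almost_3_contact \<phi> \<xi> \<eta>"
  using contact unfolding abelian_almost_3_contact_def by blast

lemma contact_i: "almost_contact (\<phi> i) (\<xi> i) (\<eta> i)"
  using contact3 unfolding almost_3_contact_def by blast

lemma lin_phi: "linear (\<phi> i)" and lin_eta: "linear (\<eta> i)"
  and phi_sq: "\<phi> i (\<phi> i X) = - X + \<eta> i X *\<^sub>R \<xi> i" and eta_xi_self: "\<eta> i (\<xi> i) = 1"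
  using contact_i[of i] unfolding almost_contact_def by blast+

lemmas lin = linear_add[OF lin_phi] linear_scale[OF lin_phi] linear_neg[OF lin_phi]
  linear_diff[OF lin_phi] linear_0[OF lin_phi]
  linear_add[OF lin_eta] linear_scale[OF lin_eta] linear_neg[OF lin_eta]
  linear_diff[OF lin_eta] linear_0[OF lin_eta]

lemma ad_xi_phi: "br (\<xi> i) (\<phi> i X) = \<phi> i (br (\<xi> i) X)"
  using contact unfolding abelian_almost_3_contact_def abelian_almost_contact_def by blast

lemma br_phi_phi: "\<eta> i X = 0 \<Longrightarrow> \<eta> i Y = 0 \<Longrightarrow> br (\<phi> i X) (\<phi> i Y) = br X Y"
  using contact unfolding abelian_almost_3_contact_def abelian_almost_contact_def by blast

lemma
  assumes "even_perm3 i j k"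
  shows phi_comp: "\<phi> i (\<phi> j X) = \<phi> k X + \<eta> j X *\<^sub>R \<xi> i"
      "\<phi> j (\<phi> i X) = - \<phi> k X + \<eta> i X *\<^sub>R \<xi> j"
    and phi_xi: "\<phi> i (\<xi> j) = \<xi> k" "\<phi> j (\<xi> i) = - \<xi> k"
    and eta_phi: "\<eta> i (\<phi> j X) = \<eta> k X" "\<eta> j (\<phi> i X) = - \<eta> k X"
proof -
  have e: "\<phi> k X = \<phi> i (\<phi> j X) - \<eta> j X *\<^sub>R \<xi> i" "\<phi> k X = - \<phi> j (\<phi> i X) + \<eta> i X *\<^sub>R \<xi> j"
    "\<xi> k = \<phi> i (\<xi> j)" "\<xi> k = - \<phi> j (\<xi> i)" "\<eta> k X = \<eta> i (\<phi> j X)" "\<eta> k X = - \<eta> j (\<phi> i X)"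
    using contact3 assms unfolding almost_3_contact_def by blast+
  show "\<phi> i (\<phi> j X) = \<phi> k X + \<eta> j X *\<^sub>R \<xi> i" by (simp add: e(1))
  show "\<phi> j (\<phi> i X) = - \<phi> k X + \<eta> i X *\<^sub>R \<xi> j" by (simp add: e(2))
  show "\<phi> i (\<xi> j) = \<xi> k" "\<eta> i (\<phi> j X) = \<eta> k X" by (simp_all add: e(3,5))
  show "\<phi> j (\<xi> i) = - \<xi> k" "\<eta> j (\<phi> i X) = - \<eta> k X" by (simp_all add: e(4,6))
qed

lemma even_perms: "even_perm3 1 2 3" "even_perm3 2 3 1" "even_perm3 3 1 2"
  by (auto simp: even_perm3_def)

text \<open>Up to sign, \<open>\<xi> k\<close> lies in the images of both \<open>\<phi> i\<close>
  and \<open>\<phi> j\<close>, on which \<open>\<eta> i\<close> and \<open>\<eta> j\<close> vanish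
  respectively.\<close>

lemma eta_xi: "\<eta> i (\<xi> j) = (if i = j then 1 else 0)"
proof -
  have "\<eta> i (\<xi> k) = 0 \<and> \<eta> j (\<xi> k) = 0" if p: "even_perm3 i j k" for i j k
    using almost_contact_eta[OF contact_i, of i "\<xi> j"] almost_contact_eta[OF contact_i, of j "\<xi> i"]
    unfolding phi_xi[OF p] by (simp add: lin)
  from this[OF even_perms(1)] this[OF even_perms(2)] this[OF even_perms(3)] show ?thesis
    using exhaust_3[of i] exhaust_3[of j] by (auto simp: eta_xi_self)
qed

lemma eta_H: "X \<in> H \<Longrightarrow> \<eta> i X = 0"
  by (auto simp: horizontal_def)

lemma H_I: "(\<And>i. \<eta> i X = 0) \<Longrightarrow> X \<in> H"
  by (auto simp: horizontal_def)

lemma subspace_H: "subspace H"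
  by (auto simp: subspace_def eta_H lin intro!: H_I)

lemma phi_H: "X \<in> H \<Longrightarrow> \<phi> i X \<in> H"
  by (rule horizontal_phi[OF contact3])

lemma Z_H: "Z \<in> H"
  by (rule assoc_Z_horizontal[OF lie contact])

lemma psi_H: "X \<in> H \<Longrightarrow> \<psi> X \<in> H"
  by (rule assoc_psi_horizontal[OF lie contact])

lemma phi_phi_H:
  assumes "X \<in> H"
  shows "\<phi> 1 (\<phi> 1 X) = - X" "\<phi> 2 (\<phi> 2 X) = - X" "\<phi> 3 (\<phi> 3 X) = - X"
    "\<phi> 1 (\<phi> 2 X) = \<phi> 3 X" "\<phi> 2 (\<phi> 3 X) = \<phi> 1 X" "\<phi> 3 (\<phi> 1 X) = \<phi> 2 X"
    "\<phi> 2 (\<phi> 1 X) = - \<phi> 3 X" "\<phi> 3 (\<phi> 2 X) = - \<phi> 1 X" "\<phi> 1 (\<phi> 3 X) = - \<phi> 2 X"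
  using phi_sq[of 1 X] phi_sq[of 2 X] phi_sq[of 3 X]
    phi_comp[OF even_perms(1), of X] phi_comp[OF even_perms(2), of X] phi_comp[OF even_perms(3), of X]
  by (simp_all add: eta_H[OF assms])

text \<open>Replacing the three indexed objects by families depending linearly on a vector of
  \<open>\<real>\<^sup>3\<close> turns the index conventions into cross products, and makes the
  invariance under rotations of the structure visible.\<close>

definition Xi :: "real^3 \<Rightarrow> 'a" where
  "Xi a = a$1 *\<^sub>R \<xi> 1 + a$2 *\<^sub>R \<xi> 2 + a$3 *\<^sub>R \<xi> 3"

definition Phi :: "real^3 \<Rightarrow> 'a \<Rightarrow> 'a" where
  "Phi a X = a$1 *\<^sub>R \<phi> 1 X + a$2 *\<^sub>R \<phi> 2 X + a$3 *\<^sub>R \<phi> 3 X"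

lemma linear_Xi: "linear Xi"
  by (rule linearI) (simp_all add: Xi_def algebra_simps)

lemma linear_Phi: "linear (\<lambda>a. Phi a X)" and linear_Phi_right: "linear (Phi a)"
  by (rule linearI; simp add: Phi_def lin algebra_simps)+

lemmas lin_XP = linear_add[OF linear_Xi] linear_scale[OF linear_Xi] linear_neg[OF linear_Xi]
  linear_diff[OF linear_Xi] linear_0[OF linear_Xi]
  linear_add[OF linear_Phi] linear_scale[OF linear_Phi] linear_neg[OF linear_Phi]
  linear_diff[OF linear_Phi] linear_0[OF linear_Phi]
  linear_add[OF linear_Phi_right] linear_scale[OF linear_Phi_right] linear_neg[OF linear_Phi_right]
  linear_diff[OF linear_Phi_right] linear_0[OF linear_Phi_right]

lemma Xi_axis: "Xi (axis i 1) = \<xi> i"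
  using exhaust_3[of i] by (auto simp: Xi_def axis_def)

lemma Phi_H: "X \<in> H \<Longrightarrow> Phi a X \<in> H"
  by (simp add: Phi_def phi_H subspace_H subspace_add subspace_scale)

text \<open>This is the product rule of imaginary quaternions: the operators \<open>Phi a\<close>
  make \<open>H\<close> a quaternionic vector space.\<close>

lemma Phi_Phi:
  assumes "X \<in> H"
  shows "Phi a (Phi b X) = - ((a \<bullet> b) *\<^sub>R X) + Phi (cross3 a b) X"
  by (simp add: Phi_def lin phi_phi_H[OF assms] cross_components inner_vec_def sum_3 algebra_simps)

section \<open>Brackets in terms of psi, delta and Z\<close>

lemma linear_psi: "linear \<psi>"
  by (rule linearI) (simp_all add: assoc_psi_def lin bl)

lemmas lin_psi = linear_add[OF linear_psi] linear_scale[OF linear_psi] linear_neg[OF linear_psi]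
  linear_diff[OF linear_psi] linear_0[OF linear_psi]

text \<open>Bracketing with \<open>\<xi> i\<close> commutes with \<open>\<phi> i\<close>, which
  squares to -1 on \<open>H\<close>. Hence \<psi> alone encodes all brackets of vertical with
  horizontal vectors.\<close>

lemma br_xi_H: "br (\<xi> i) X = - \<phi> i (\<psi> X)" if "X \<in> H"
proof -
  have "\<phi> i (\<psi> X) = br (\<xi> i) (\<phi> i (\<phi> i X))"
    by (simp add: assoc_psi_eq(1)[OF lie contact that, of i] ad_xi_phi)
  then show ?thesis by (simp add: phi_sq eta_H[OF that] bl)
qed

lemma psi_phi: "\<psi> (\<phi> i X) = \<phi> i (\<psi> X)" if "X \<in> H"
proof -
  have "\<psi> (\<phi> i X) = br (\<xi> i) (\<phi> i (\<phi> i X))"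
    by (rule assoc_psi_eq(1)[OF lie contact phi_H[OF that]])
  then show ?thesis by (simp add: phi_sq eta_H[OF that] bl br_xi_H[OF that])
qed

lemma psi_Phi: "X \<in> H \<Longrightarrow> \<psi> (Phi a X) = Phi a (\<psi> X)"
  by (simp add: Phi_def lin_psi psi_phi)

lemma br_Xi_H: "X \<in> H \<Longrightarrow> br (Xi a) X = - Phi a (\<psi> X)"
  by (simp add: Xi_def Phi_def bl br_xi_H)

text \<open>The factor 1/2 is chosen so that in the invertible case \<open>\<xi> i\<close> acts on
  \<open>H\<close> as \<delta> times \<open>\<phi> i\<close>.\<close>

definition \<delta> :: real where "\<delta> = \<eta> 1 (br (\<xi> 2) (\<xi> 3)) / 2"

text \<open>The vertical coefficient is invariant under cyclic rotation because bracketing with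
  \<open>\<xi> i\<close> commutes with \<open>\<phi> i\<close>. The rest is recovered by applying
  \<open>\<phi> k\<close> to \<open>Z\<close>, which is \<open>\<phi> k\<close> of this very
  bracket.\<close>

lemma br_xi_xi:
  assumes p: "even_perm3 i j k"
  shows "br (\<xi> i) (\<xi> j) = (2 * \<delta>) *\<^sub>R \<xi> k - \<phi> k Z"
proof -
  have e: "\<eta> j (br (\<xi> k) (\<xi> i)) = \<eta> k (br (\<xi> i) (\<xi> j))" if "even_perm3 i j k" for i j k
  proof -
    have "br (\<xi> i) (\<xi> k) = \<phi> i (br (\<xi> i) (\<xi> j))"
      using ad_xi_phi[of i "\<xi> j"] by (simp add: phi_xi[OF that])
    then have "br (\<xi> k) (\<xi> i) = - \<phi> i (br (\<xi> i) (\<xi> j))" using swap[of "\<xi> k"] by simp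
    then show ?thesis by (simp add: lin eta_phi[OF that])
  qed
  have "\<eta> k (br (\<xi> i) (\<xi> j)) = 2 * \<delta>"
    using p e[OF even_perms(1)] e[OF even_perms(2)] e[OF even_perms(3)]
    by (auto simp: even_perm3_def \<delta>_def)
  moreover have "even_perm3 k i j" using p by (auto simp: even_perm3_def)
  then have "\<phi> k Z = \<phi> k (\<phi> k (br (\<xi> i) (\<xi> j)))"
    by (simp add: assoc_Z_eq[OF lie contact])
  ultimately show ?thesis by (simp add: phi_sq)
qed

lemma br_Xi_Xi: "br (Xi a) (Xi b) = (2 * \<delta>) *\<^sub>R Xi (cross3 a b) - Phi (cross3 a b) Z"
proof -
  note b = br_xi_xi[OF even_perms(1)] br_xi_xi[OF even_perms(2)] br_xi_xi[OF even_perms(3)]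
  have c: "br (\<xi> 2) (\<xi> 1) = - br (\<xi> 1) (\<xi> 2)" "br (\<xi> 3) (\<xi> 2) = - br (\<xi> 2) (\<xi> 3)"
    "br (\<xi> 1) (\<xi> 3) = - br (\<xi> 3) (\<xi> 1)"
    by (rule swap)+
  show ?thesis
    by (simp add: Xi_def Phi_def bl alt c b cross_components algebra_simps)
qed

text \<open>In the Jacobi identity of the three \<open>\<xi> i\<close> the \<delta> terms cancel,
  while each \<open>\<phi> i Z\<close> contributes the same vector \<psi> Z; three times this vector
  is zero.\<close>

lemma psi_Z: "\<psi> Z = 0"
proof -
  have e: "br (\<xi> i) (\<phi> i Z) = \<psi> Z" for i
    by (simp add: assoc_psi_eq(1)[OF lie contact Z_H, of i])
  have "br (\<xi> 1) (br (\<xi> 2) (\<xi> 3)) = br (br (\<xi> 1) (\<xi> 2)) (\<xi> 3) + br (\<xi> 2) (br (\<xi> 1) (\<xi> 3))"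
    by (rule jacobi)
  moreover have "br (\<xi> 1) (\<xi> 3) = - ((2 * \<delta>) *\<^sub>R \<xi> 2 - \<phi> 2 Z)"
    using br_xi_xi[OF even_perms(3)] swap[of "\<xi> 1"] by simp
  ultimately have "- \<psi> Z = br (\<xi> 3) (\<phi> 3 Z) + \<psi> Z"
    by (simp add: br_xi_xi[OF even_perms(1)] br_xi_xi[OF even_perms(2)] bl e alt
         swap[of "\<phi> 3 Z" "\<xi> 3"])
  then have "\<psi> Z + \<psi> Z + \<psi> Z = 0"
    unfolding e by (metis add.commute add.right_inverse)
  then have "(1 + 1 + 1 :: real) *\<^sub>R \<psi> Z = 0" by (simp only: scaleR_left_distrib scaleR_one)
  then show ?thesis by simp
qed

text \<open>Jacobi identity for \<open>\<xi> i\<close>, \<open>\<xi> j\<close>, \<open>X\<close>. On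
  \<open>H\<close> the commutator of the two adjoint maps is 2 \<open>\<phi> k\<close> \<psi>\<psi>,
  whereas the bracket of \<open>\<xi> i\<close> and \<open>\<xi> j\<close> involves
  \<open>\<phi> k Z\<close>; solving for the latter gives the formula.\<close>

lemma br_phi_Z:
  assumes X: "X \<in> H"
  shows "br (\<phi> k Z) X = - (2 *\<^sub>R \<phi> k (\<psi> (\<psi> X) + \<delta> *\<^sub>R \<psi> X))"
proof -
  obtain i j where p: "even_perm3 i j k"
    using exhaust_3[of k] even_perms by blast
  note pH = psi_H[OF X] psi_H[OF psi_H[OF X]]
  have ad2: "br (\<xi> a) (br (\<xi> b) X) = \<phi> a (\<phi> b (\<psi> (\<psi> X)))" for a b
  proof -
    have "br (\<xi> a) (\<phi> b (\<psi> X)) = - \<phi> a (\<phi> b (\<psi> (\<psi> X)))"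
      using br_xi_H[OF phi_H[OF pH(1)]] psi_phi[OF pH(1)] by simp
    then show ?thesis by (simp add: br_xi_H[OF X] bl)
  qed
  have "br (\<xi> i) (br (\<xi> j) X) = br (br (\<xi> i) (\<xi> j)) X + br (\<xi> j) (br (\<xi> i) X)"
    by (rule jacobi)
  then have "\<phi> i (\<phi> j (\<psi> (\<psi> X))) = - ((2 * \<delta>) *\<^sub>R \<phi> k (\<psi> X)) - br (\<phi> k Z) X + \<phi> j (\<phi> i (\<psi> (\<psi> X)))"
    unfolding ad2 by (simp add: br_xi_xi[OF p] bl br_xi_H[OF X])
  then have "br (\<phi> k Z) X = - ((2 * \<delta>) *\<^sub>R \<phi> k (\<psi> X))
      + (\<phi> j (\<phi> i (\<psi> (\<psi> X))) - \<phi> i (\<phi> j (\<psi> (\<psi> X))))"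
    by (simp add: algebra_simps)
  also have "\<phi> j (\<phi> i (\<psi> (\<psi> X))) - \<phi> i (\<phi> j (\<psi> (\<psi> X))) = - (2 *\<^sub>R \<phi> k (\<psi> (\<psi> X)))"
    by (simp add: phi_comp[OF p] eta_H[OF pH(2)] scaleR_2)
  finally have "br (\<phi> k Z) X = - ((2 * \<delta>) *\<^sub>R \<phi> k (\<psi> X)) - 2 *\<^sub>R \<phi> k (\<psi> (\<psi> X))"
    by simp
  then show ?thesis by (simp add: lin scaleR_right_distrib)
qed

text \<open>Applying \<open>\<phi> i\<close> to both arguments of the bracket of
  \<open>\<phi> i X\<close> and \<open>\<phi> j X\<close> leaves it unchanged and turns the
  arguments into \<open>- X\<close> and \<open>\<phi> k X\<close>.\<close>

lemma br_Phi_Phi: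
  assumes X: "X \<in> H"
  shows "br (Phi a X) (Phi b X) = - br X (Phi (cross3 a b) X)"
proof -
  note h = eta_H[OF X] eta_H[OF phi_H[OF X]]
  have "br (\<phi> i X) (\<phi> j X) = - br X (\<phi> k X)" if p: "even_perm3 i j k" for i j k
    using br_phi_phi[of i "\<phi> i X" "\<phi> j X"] by (simp add: h phi_sq phi_comp[OF p] bl)
  note b = this[OF even_perms(1)] this[OF even_perms(2)] this[OF even_perms(3)]
  have c: "br (\<phi> 2 X) (\<phi> 1 X) = - br (\<phi> 1 X) (\<phi> 2 X)" "br (\<phi> 3 X) (\<phi> 2 X) = - br (\<phi> 2 X) (\<phi> 3 X)"
    "br (\<phi> 1 X) (\<phi> 3 X) = - br (\<phi> 3 X) (\<phi> 1 X)"
    by (rule swap)+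
  show ?thesis
    by (simp add: Phi_def bl alt c b cross_components algebra_simps)
qed

text \<open>With p = s + a and q = t + b read as quaternions, the argument on the right is the
  imaginary part of conj(p) q. All brackets on the quaternionic line through \<open>X\<close> are
  thus values of one linear map.\<close>

lemma br_H:
  assumes X: "X \<in> H"
  shows "br (s *\<^sub>R X + Phi a X) (t *\<^sub>R X + Phi b X) = br X (Phi (s *\<^sub>R b - t *\<^sub>R a - cross3 a b) X)"
  by (simp add: bl alt br_Phi_Phi[OF X] swap[of "Phi a X" X] lin_XP)

end

section \<open>Dimension seven: the horizontal space is a quaternionic line\<close>

locale abelian_3_contact_7 = abelian_3_contact +
  assumes dim7: "dim (UNIV :: 'a set) = 7"
begin

lemma linear_coords: "linear (\<lambda>(x, t, a). Xi x + t *\<^sub>R X + Phi a X)"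
  by (rule linearI) (auto simp: lin_XP algebra_simps)

text \<open>As 3 + 1 + 3 = 7, injectivity is enough: the forms \<open>\<eta> i\<close> read off
  \<open>x\<close>, and a nonzero quaternion acts injectively on \<open>H\<close>.\<close>

lemma bij_coords:
  assumes X: "X \<in> H" "X \<noteq> 0"
  shows "bij (\<lambda>(x, t, a). Xi x + t *\<^sub>R X + Phi a X)" (is "bij ?G")
proof -
  have z: "x = 0 \<and> t = 0 \<and> a = 0" if 0: "Xi x + t *\<^sub>R X + Phi a X = 0" for x t a
  proof -
    have "\<eta> i (Xi x) = 0" for i
    proof -
      have "\<eta> i (Xi x + t *\<^sub>R X + Phi a X) = 0" using 0 by (simp add: lin)
      then show ?thesis by (simp add: lin eta_H[OF X(1)] eta_H[OF Phi_H[OF X(1)]])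
    qed
    from this[of 1] this[of 2] this[of 3] have x: "x = 0"
      by (simp add: Xi_def lin eta_xi vec_eq_iff forall_3)
    with 0 have 1: "t *\<^sub>R X + Phi a X = 0" by (simp add: lin_XP)
    \<comment> \<open>Multiplication by the conjugate quaternion t - a leaves the squared norm times
      \<open>X\<close>.\<close>
    then have "t *\<^sub>R (t *\<^sub>R X + Phi a X) - Phi a (t *\<^sub>R X + Phi a X) = 0" by (simp add: lin_XP)
    then have "(t * t + a \<bullet> a) *\<^sub>R X = 0"
      by (simp add: lin_XP Phi_Phi[OF X(1)] algebra_simps)
    then have "t * t + a \<bullet> a = 0" using X(2) by simp
    then show ?thesis using x by (simp add: add_nonneg_eq_0_iff)
  qed
  have "inj ?G" unfolding linear_injective_0[OF linear_coords] by (auto dest!: z simp: zero_prod_def)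
  then show ?thesis
    using linear_inj_imp_surj_dim[OF linear_coords] dim7 by (simp add: bij_def)
qed

lemma coordsE:
  assumes "X \<in> H" "X \<noteq> 0"
  obtains x t a where "Y = Xi x + t *\<^sub>R X + Phi a X"
proof -
  have "Y \<in> range (\<lambda>(x, t, a). Xi x + t *\<^sub>R X + Phi a X)"
    using bij_is_surj[OF bij_coords[OF assms]] by simp
  then show thesis using that by auto
qed

lemma eta_Xi: "\<eta> i (Xi x) = x $ i"
  using exhaust_3[of i] by (auto simp: Xi_def lin eta_xi)

lemma H_coordsE:
  assumes X: "X \<in> H" "X \<noteq> 0" and Y: "Y \<in> H"
  obtains t a where "Y = t *\<^sub>R X + Phi a X"
proof -
  obtain x t a where e: "Y = Xi x + t *\<^sub>R X + Phi a X" using coordsE[OF X] .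
  have "x $ i = \<eta> i Y" for i
    using eta_H[OF X(1)] eta_H[OF Phi_H[OF X(1)]] by (simp add: e lin eta_Xi)
  then have "x = 0" using eta_H[OF Y] by (simp add: vec_eq_iff)
  then show thesis using e that by (simp add: lin_XP)
qed

lemma H_nonzero: obtains (nonzero) X where "X \<in> H" "X \<noteq> 0"
proof (rule ccontr)
  assume "\<not> thesis"
  then have z: "X = 0" if "X \<in> H" for X using that nonzero by blast
  have "Y \<in> span {\<xi> 1, \<xi> 2, \<xi> 3}" for Y
  proof -
    have "Y - Xi (\<chi> i. \<eta> i Y) = 0" by (rule z, rule H_I) (simp add: lin eta_Xi)
    then have "Y = Xi (\<chi> i. \<eta> i Y)" by simp
    also have "\<dots> \<in> span {\<xi> 1, \<xi> 2, \<xi> 3}"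
      unfolding Xi_def by (intro span_add span_scale span_base) auto
    finally show ?thesis .
  qed
  then have "dim (UNIV :: 'a set) \<le> card {\<xi> 1, \<xi> 2, \<xi> 3}"
    by (intro dim_le_card) auto
  also have "\<dots> \<le> 3" by (simp add: card_insert_if)
  finally show False using dim7 by simp
qed

text \<open>Since \<psi> commutes with every \<open>Phi a\<close>, a single nonzero kernel vector
  puts its whole quaternionic line, which is \<open>H\<close>, into the kernel.\<close>

lemma psi_zero_or_inj:
  "(\<forall>X\<in>H. \<psi> X = 0) \<or> (\<forall>X\<in>H. \<psi> X = 0 \<longrightarrow> X = 0)"
proof (cases "\<exists>X\<in>H. X \<noteq> 0 \<and> \<psi> X = 0")
  case True
  then obtain X where X: "X \<in> H" "X \<noteq> 0" "\<psi> X = 0" by blast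
  have "\<psi> Y = 0" if Y: "Y \<in> H" for Y
  proof -
    obtain t a where "Y = t *\<^sub>R X + Phi a X" using H_coordsE[OF X(1,2) Y] .
    then show ?thesis by (simp add: lin_psi psi_Phi[OF X(1)] X(3) lin_XP)
  qed
  then show ?thesis by blast
qed blast

lemma psi_zero_or_bij:
  "bij_betw \<psi> H H \<or> (\<forall>X\<in>H. \<psi> X = 0)"
proof (cases "\<forall>X\<in>H. \<psi> X = 0")
  case False
  then have i: "X = 0" if "X \<in> H" "\<psi> X = 0" for X using psi_zero_or_inj that by blast
  have "inj_on \<psi> H"
  proof (rule inj_onI)
    fix X Y assume "X \<in> H" "Y \<in> H" "\<psi> X = \<psi> Y"
    then have "X - Y = 0" using i[of "X - Y"] by (simp add: subspace_diff[OF subspace_H] lin_psi)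
    then show "X = Y" by simp
  qed
  moreover have "Y \<in> \<psi> ` H" if Y: "Y \<in> H" for Y
  proof -
    obtain X where X: "X \<in> H" "X \<noteq> 0" using H_nonzero .
    \<comment> \<open>The nonzero image vector generates \<open>H\<close> in its turn, which gives
      surjectivity.\<close>
    have p: "\<psi> X \<in> H" "\<psi> X \<noteq> 0" using X i psi_H by blast+
    obtain t a where "Y = t *\<^sub>R \<psi> X + Phi a (\<psi> X)" using H_coordsE[OF p Y] .
    then have "Y = \<psi> (t *\<^sub>R X + Phi a X)" by (simp add: lin_psi psi_Phi[OF X(1)])
    moreover have "t *\<^sub>R X + Phi a X \<in> H"
      using X(1) by (simp add: Phi_H subspace_H subspace_add subspace_scale)
    ultimately show ?thesis by blast
  qed
  ultimately show ?thesis using psi_H by (auto simp: bij_betw_def)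
qed blast

end

section \<open>The cases \<open>\<psi>\<close> invertible and \<open>Z\<close> nonzero\<close>

context abelian_3_contact_7
begin

lemma Xi_H_eq_0:
  assumes "Xi a + V = 0" "V \<in> H"
  shows "a = 0" "V = 0"
proof -
  have "a $ i = 0" for i
  proof -
    have "\<eta> i (Xi a + V) = 0" using assms(1) by (simp add: lin)
    then show ?thesis by (simp add: lin eta_Xi eta_H[OF assms(2)])
  qed
  then show "a = 0" by (simp add: vec_eq_iff)
  then show "V = 0" using assms(1) by (simp add: lin_XP)
qed

lemma Xi_H_decompE:
  obtains x V where "Y = Xi x + V" "V \<in> H"
proof -
  have "Y - Xi (\<chi> i. \<eta> i Y) \<in> H" by (rule H_I) (simp add: lin eta_Xi)
  then show thesis using that[of "\<chi> i. \<eta> i Y" "Y - Xi (\<chi> i. \<eta> i Y)"] by simp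
qed

lemma vertical_eq: "vertical \<xi> = range Xi"
proof
  have "subspace (range Xi)"
    using linear_subspace_image[OF linear_Xi subspace_UNIV] by simp
  moreover have "{\<xi> 1, \<xi> 2, \<xi> 3} \<subseteq> range Xi"
    using Xi_axis by (metis empty_subsetI insert_subset rangeI)
  ultimately show "vertical \<xi> \<subseteq> range Xi" unfolding vertical_def by (simp add: span_minimal)
  show "range Xi \<subseteq> vertical \<xi>"
    unfolding vertical_def Xi_def by (auto intro!: span_add span_scale intro: span_base)
qed

text \<open>The quaternionic line through \<open>X\<close> with coordinates in the order 1, i, j,
  k.\<close>

definition quat :: "'a \<Rightarrow> real^4 \<Rightarrow> 'a" where
  "quat X y = y$1 *\<^sub>R X + Phi (vector [y$2, y$3, y$4]) X"

lemma linear_quat: "linear (quat X)"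
  by (rule linearI) (simp_all add: quat_def Phi_def algebra_simps)

lemma quat_H: "X \<in> H \<Longrightarrow> quat X y \<in> H"
  by (simp add: quat_def Phi_H subspace_H subspace_add subspace_scale)

lemma quat_surjE:
  assumes "X \<in> H" "X \<noteq> 0" "V \<in> H"
  obtains y where "V = quat X y"
proof -
  obtain t a where "V = t *\<^sub>R X + Phi a X" using H_coordsE[OF assms] .
  then have "V = quat X (t *\<^sub>R axis 1 1 + a$1 *\<^sub>R axis 2 1 + a$2 *\<^sub>R axis 3 1 + a$3 *\<^sub>R axis 4 1)"
    by (simp add: quat_def Phi_def axis_def)
  then show thesis by (rule that)
qed

lemma inj_quat:
  assumes "X \<in> H" "X \<noteq> 0"
  shows "inj (quat X)"
  unfolding linear_injective_0[OF linear_quat]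
proof (intro allI impI)
  fix y assume "quat X y = 0"
  then have "(\<lambda>(x, t, a). Xi x + t *\<^sub>R X + Phi a X) (0, y$1, vector [y$2, y$3, y$4])
     = (\<lambda>(x, t, a). Xi x + t *\<^sub>R X + Phi a X) (0, 0, 0)"
    by (simp add: quat_def lin_XP)
  then have "(0 :: real^3, y$1, vector [y$2, y$3, y$4] :: real^3) = (0, 0, 0)"
    by (rule injD[OF bij_is_inj[OF bij_coords[OF assms]]])
  then show "y = 0" by (simp add: vec_eq_iff forall_3 forall_4)
qed

text \<open>\<open>Z\<close> lies in the kernel of \<psi>, so it vanishes. Then
  \<open>br_phi_Z\<close> says that \<psi>(\<psi> + \<delta>) = 0 on \<open>H\<close>, where the
  outer \<psi> can be cancelled; \<delta> = 0 would annihilate the nonzero space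
  \<open>H\<close>.\<close>

lemma
  assumes b: "bij_betw \<psi> H H"
  shows invertible_Z: "Z = 0"
    and invertible_psi: "X \<in> H \<Longrightarrow> \<psi> X = - (\<delta> *\<^sub>R X)"
    and invertible_delta: "\<delta> \<noteq> 0"
proof -
  have i: "X = 0" if "X \<in> H" "\<psi> X = 0" for X
    using bij_betw_imp_inj_on[OF b] that subspace_0[OF subspace_H]
    by (metis inj_onD linear_0 linear_psi)
  show Z0: "Z = 0" using i[OF Z_H psi_Z] .
  show 1: "\<psi> X = - (\<delta> *\<^sub>R X)" if X: "X \<in> H" for X
  proof -
    let ?W = "\<psi> X + \<delta> *\<^sub>R X"
    have W: "?W \<in> H" using X by (simp add: psi_H subspace_H subspace_add subspace_scale)
    have "\<phi> 1 (\<psi> ?W) = 0"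
      using br_phi_Z[OF X, of 1] by (simp add: Z0 lin bl lin_psi)
    then have "\<phi> 1 (\<phi> 1 (\<psi> ?W)) = 0" by (simp add: lin)
    then have "\<psi> ?W = 0" by (simp add: phi_sq eta_H[OF psi_H[OF W]])
    then have "?W = 0" by (rule i[OF W])
    then show ?thesis by (simp add: eq_neg_iff_add_eq_0)
  qed
  show "\<delta> \<noteq> 0"
    using H_nonzero 1 i by (metis neg_0_equal_iff_equal scaleR_zero_left)
qed

text \<open>The abelian condition makes \<open>\<phi> i\<close> skew for the bracket on
  \<open>H\<close>, so the two Leibniz terms cancel.\<close>

lemma br_xi_br_H:
  assumes "X \<in> H" "Y \<in> H" "\<And>X. X \<in> H \<Longrightarrow> br (\<xi> i) X = c *\<^sub>R \<phi> i X"
  shows "br (\<xi> i) (br X Y) = 0"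
proof -
  have "br X (\<phi> i Y) = - br (\<phi> i X) Y"
    using br_phi_phi[of i X "\<phi> i Y"] assms by (simp add: eta_H phi_H phi_sq bl)
  then show ?thesis
    using assms by (simp add: jacobi[of "\<xi> i" X Y] bl)
qed

lemma br_Xi_iff_xi: "(\<forall>a. br (Xi a) W = 0) \<longleftrightarrow> (\<forall>i. br (\<xi> i) W = 0)"
proof
  show "\<forall>i. br (\<xi> i) W = 0" if "\<forall>a. br (Xi a) W = 0" using that Xi_axis by metis
qed (simp add: Xi_def bl)

text \<open>The vertical part of the bracket of \<open>Xi a\<close> with \<open>Xi x\<close> is a
  nonzero multiple of \<open>Xi (cross3 a x)\<close>, and only 0 has vanishing cross product with
  every vector.\<close>

lemma Xi_central_0:
  assumes "\<And>a. br (Xi a) (Xi x) = 0" "\<delta> \<noteq> 0"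
  shows "x = 0"
proof -
  have "cross3 a x = 0" for a
  proof -
    have "Xi ((2 * \<delta>) *\<^sub>R cross3 a x) + - Phi (cross3 a x) Z = 0"
      using assms(1)[of a] by (simp add: br_Xi_Xi lin_XP)
    then have "(2 * \<delta>) *\<^sub>R cross3 a x = 0"
      by (rule Xi_H_eq_0(1)) (simp add: Phi_H Z_H subspace_H subspace_neg)
    then show ?thesis using assms(2) by simp
  qed
  then show ?thesis
    using cross_basis_nonzero[of x] cross_skew by (metis neg_0_equal_iff_equal)
qed

text \<open>The bracket of two horizontal vectors is annihilated by all vertical ones. But there are
  no invariant vectors: the vertical part moves by cross products and the horizontal part by nonzero
  quaternions.\<close>

lemma invertible_H_abelian:
  assumes b: "bij_betw \<psi> H H" and XY: "X \<in> H" "Y \<in> H"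
  shows "br X Y = 0"
proof -
  have xi: "br (\<xi> i) V = \<delta> *\<^sub>R \<phi> i V" if "V \<in> H" for i V
    using that by (simp add: br_xi_H invertible_psi[OF b] lin)
  obtain x V where W: "br X Y = Xi x + V" "V \<in> H" using Xi_H_decompE .
  have "br (\<xi> i) (br X Y) = 0" for i by (rule br_xi_br_H[OF XY xi])
  then have 0: "br (Xi a) (br X Y) = 0" for a using br_Xi_iff_xi by blast
  have 1: "cross3 a x = 0 \<and> Phi a V = 0" for a
  proof -
    have "Xi ((2 * \<delta>) *\<^sub>R cross3 a x) + \<delta> *\<^sub>R Phi a V = 0"
      using 0[of a] W by (simp add: bl br_Xi_Xi invertible_Z[OF b] br_Xi_H invertible_psi[OF b] lin_XP)
    moreover have "\<delta> *\<^sub>R Phi a V \<in> H" using W by (simp add: Phi_H subspace_H subspace_scale)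
    ultimately have "(2 * \<delta>) *\<^sub>R cross3 a x = 0" "\<delta> *\<^sub>R Phi a V = 0" using Xi_H_eq_0 by blast+
    then show ?thesis using invertible_delta[OF b] by simp
  qed
  then have "x = 0" using cross_basis_nonzero[of x] cross_skew by (metis neg_0_equal_iff_equal)
  moreover have "Phi (axis 1 1) (Phi (axis 1 1) V) = 0" using 1 by (simp add: lin_XP)
  then have "V = 0" by (simp add: Phi_Phi[OF W(2)] lin_XP)
  ultimately show ?thesis using W by (simp add: lin_XP)
qed

lemma invertible_iso:
  assumes b: "bij_betw \<psi> H H"
  shows "\<exists>\<rho> f. lie_action so3_bracket (abelian_bracket :: real^4 \<Rightarrow> _) \<rho> \<and>
               lie_iso_map br (semidirect_bracket so3_bracket abelian_bracket \<rho>) f \<and>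
               f ` vertical \<xi> = UNIV \<times> {0} \<and> f ` horizontal \<eta> = {0} \<times> UNIV"
proof -
  obtain X where X: "X \<in> H" "X \<noteq> 0" using H_nonzero .
  note d0 = invertible_delta[OF b]
  have ax: "linear axial" "bij axial" "\<And>A B. axial (so3_bracket A B) = cross3 (axial A) (axial B)"
    using axial_iso by (auto simp: lie_iso_map_def)
  let ?q = "quat X"
  obtain k where k: "linear k" "k \<circ> ?q = id"
    using linear_injective_left_inverse[OF linear_quat inj_quat[OF X]] by blast
  have qk: "?q (k V) = V" if "V \<in> H" for V
    using quat_surjE[OF X that] k(2) by (metis comp_apply id_apply)
  \<comment> \<open>Division by 2\<delta> normalises the vertical brackets to the cross
    product.\<close>
  define v where "v A = Xi ((1 / (2 * \<delta>)) *\<^sub>R axial A)" for A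
  have lv: "linear v"
    by (rule linearI) (simp_all add: v_def linear_add[OF ax(1)] linear_scale[OF ax(1)] lin_XP algebra_simps)
  have vb: "v (so3_bracket A B) = br (v A) (v B)" for A B
    using d0 by (simp add: v_def ax(3) br_Xi_Xi invertible_Z[OF b] cross_mult_left cross_mult_right lin_XP bl)
  have rv: "range v = range Xi"
  proof -
    have "Xi a \<in> range v" for a
    proof -
      obtain A where "(2 * \<delta>) *\<^sub>R a = axial A" using ax(2) by (metis bij_pointE)
      then have "v A = Xi a" using d0 by (simp add: v_def flip: \<open>(2 * \<delta>) *\<^sub>R a = axial A\<close>)
      then show ?thesis by (metis rangeI)
    qed
    then show ?thesis by (auto simp: v_def)
  qed
  have rq: "range ?q = H" using quat_surjE[OF X] quat_H[OF X(1)] by blast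
  \<comment> \<open>The adjoint action on \<open>H\<close>, transported to the model;
    \<open>k\<close> inverts \<open>quat X\<close> on \<open>H\<close>, which this action
    preserves.\<close>
  define \<rho> where "\<rho> A y = k (br (v A) (?q y))" for A y
  have vH: "br (v A) V \<in> H" if "V \<in> H" for A V
    using that by (simp add: v_def br_Xi_H Phi_H psi_H subspace_H subspace_neg)
  have q\<rho>: "?q (\<rho> A y) = br (v A) (?q y)" for A y
    unfolding \<rho>_def by (rule qk, rule vH, rule quat_H[OF X(1)])
  note lq = linear_add[OF linear_quat] linear_scale[OF linear_quat] linear_diff[OF linear_quat]
    linear_0[OF linear_quat]
  have act: "lie_action so3_bracket abelian_bracket \<rho>"
  proof -
    have "bilinear \<rho>"
      unfolding bilinear_def linear_iff \<rho>_def
      by (simp add: linear_add[OF lv] linear_scale[OF lv] lq bl linear_add[OF k(1)] linear_scale[OF k(1)])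
    moreover have "\<rho> (so3_bracket x y) u = \<rho> x (\<rho> y u) - \<rho> y (\<rho> x u)" for x y u
      by (rule injD[OF inj_quat[OF X]]) (simp add: lq q\<rho> vb jacobi[of "v x" "v y"])
    \<comment> \<open>For the zero bracket the derivation law reduces to this.\<close>
    moreover have "\<rho> x 0 = 0" for x
      by (rule injD[OF inj_quat[OF X]]) (simp add: lq q\<rho> bl)
    ultimately show ?thesis by (simp add: lie_action_def abelian_bracket_def)
  qed
  define G where "G p = v (fst p) + ?q (snd p)" for p
  have lG: "linear G"
    by (rule linearI) (simp_all add: G_def linear_add[OF lv] linear_scale[OF lv] lq algebra_simps)
  have "inj G" unfolding linear_injective_0[OF lG]
  proof (intro allI impI)
    fix p assume "G p = 0"
    then have "(1 / (2 * \<delta>)) *\<^sub>R axial (fst p) = 0" "?q (snd p) = 0"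
      using Xi_H_eq_0[OF _ quat_H[OF X(1)]] unfolding G_def v_def by blast+
    then have "axial (fst p) = axial 0" "?q (snd p) = ?q 0"
      using d0 by (simp_all add: linear_0[OF ax(1)] lq)
    then show "p = 0"
      using injD[OF bij_is_inj[OF ax(2)]] injD[OF inj_quat[OF X]] by (metis prod.collapse zero_prod_def)
  qed
  moreover have "surj G" unfolding surj_def
  proof
    fix Y obtain x V where Y: "Y = Xi x + V" "V \<in> H" using Xi_H_decompE .
    then obtain A y where "Xi x = v A" "V = ?q y" using rv rq by (metis rangeE rangeI)
    then show "\<exists>p. Y = G p" using Y by (intro exI[of _ "(A, y)"]) (simp add: G_def)
  qed
  ultimately have bG: "bij G" by (simp add: bij_def)
  have Gb: "G (semidirect_bracket so3_bracket abelian_bracket \<rho> p q) = br (G p) (G q)" for p q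
    using invertible_H_abelian[OF b quat_H[OF X(1)] quat_H[OF X(1)]] swap[of "?q (snd p)" "v (fst q)"]
    by (simp add: G_def semidirect_bracket_def abelian_bracket_def vb lq q\<rho> bl)
  then have "lie_iso_map br (semidirect_bracket so3_bracket abelian_bracket \<rho>) (inv G)"
    using lG bG by (intro lie_iso_map_inv) (simp add: lie_iso_map_def)
  moreover have "G ` (UNIV \<times> {0}) = vertical \<xi>"
    unfolding vertical_eq rv[symmetric] by (force simp: G_def lq image_iff)
  then have "inv G ` vertical \<xi> = UNIV \<times> {0}"
    by (metis bG bij_is_inj image_inv_f_f)
  moreover have "G ` ({0} \<times> UNIV) = H"
    unfolding rq[symmetric] by (force simp: G_def linear_0[OF lv] image_iff)
  then have "inv G ` H = {0} \<times> UNIV"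
    by (metis bG bij_is_inj image_inv_f_f)
  ultimately show ?thesis using act by blast
qed

end

section \<open>Vanishing psi: vertical and horizontal vectors commute\<close>

locale psi_zero = abelian_3_contact_7 +
  assumes psi_zero: "X \<in> H \<Longrightarrow> \<psi> X = 0"
begin

lemma br_Xi_H_0: "X \<in> H \<Longrightarrow> br (Xi a) X = 0" and br_H_Xi_0: "X \<in> H \<Longrightarrow> br X (Xi a) = 0"
  using swap[of X "Xi a"] by (simp_all add: br_Xi_H psi_zero lin_XP)

lemma br_Phi_Z: "X \<in> H \<Longrightarrow> br (Phi a Z) X = 0"
  by (simp add: Phi_def bl br_phi_Z psi_zero lin_psi lin)

lemma so3_times_abelian:
  assumes ab: "\<And>X Y. X \<in> H \<Longrightarrow> Y \<in> H \<Longrightarrow> br X Y = 0" and d: "\<delta> \<noteq> 0"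
  shows "lie_isomorphic br (prod_bracket so3_bracket (abelian_bracket :: real^4 \<Rightarrow> _))"
proof -
  obtain X where X: "X \<in> H" "X \<noteq> 0" using H_nonzero .
  \<comment> \<open>The correction absorbs the term \<open>Phi (cross3 a b) Z\<close> of
    \<open>br_Xi_Xi\<close>, so that \<open>range v\<close> is closed under the bracket.\<close>
  define v where "v a = Xi a - (1 / (2 * \<delta>)) *\<^sub>R Phi a Z" for a
  show ?thesis
  proof (rule lie_isomorphic_so3_prodI[OF lie, of v "quat X" \<delta>])
    show "linear v" by (rule linearI) (simp_all add: v_def lin_XP algebra_simps)
    have p: "br (Xi a) (Phi b Z) = 0" "br (Phi b Z) (Xi a) = 0" "br (Phi b Z) (Phi a Z) = 0" for a b
      using br_Xi_H_0 br_H_Xi_0 ab Phi_H[OF Z_H] by blast+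
    show "br (v a) (v b) = (2 * \<delta>) *\<^sub>R v (cross3 a b)" for a b
      using d by (simp add: v_def bl p br_Xi_Xi algebra_simps)
    show "br (v a) (quat X y) = 0" for a y
      using quat_H[OF X(1), of y] by (simp add: v_def bl br_Xi_H_0 br_Phi_Z)
    show "quat X (abelian_bracket x y) = br (quat X x) (quat X y)" for x y
      using ab quat_H[OF X(1)] by (simp add: abelian_bracket_def linear_0[OF linear_quat])
    show "\<exists>x y. Y = v x + quat X y" for Y
    proof -
      obtain x V where Y: "Y = Xi x + V" "V \<in> H" using Xi_H_decompE .
      then have "V + (1 / (2 * \<delta>)) *\<^sub>R Phi x Z \<in> H"
        using Phi_H[OF Z_H] by (simp add: subspace_H subspace_add subspace_scale)
      then obtain y where "V + (1 / (2 * \<delta>)) *\<^sub>R Phi x Z = quat X y" using quat_surjE[OF X] by blast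
      then have "Y = v x + quat X y" using Y by (simp add: v_def algebra_simps)
      then show ?thesis by blast
    qed
  qed (use d dim7 linear_quat in auto)
qed

text \<open>\<open>Z\<close> itself generates the quaternionic line \<open>H\<close>, and each
  \<open>Phi a Z\<close> commutes with \<open>H\<close> by \<open>br_Phi_Z\<close>.\<close>

lemma Z_nonzero_H_abelian:
  assumes "Z \<noteq> 0" "X \<in> H" "Y \<in> H"
  shows "br X Y = 0"
proof -
  obtain s a where X: "X = s *\<^sub>R Z + Phi a Z" using H_coordsE[OF Z_H assms(1,2)] .
  obtain t b where Y: "Y = t *\<^sub>R Z + Phi b Z" using H_coordsE[OF Z_H assms(1,3)] .
  have "br Z (Phi b Z) = 0" using br_Phi_Z[OF Z_H, of b] swap[of Z "Phi b Z"] by simp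
  then show ?thesis
    unfolding X Y by (simp add: bl alt br_Phi_Z Z_H Phi_H)
qed

lemma Z_nonzero_nilpotent:
  assumes Z: "Z \<noteq> 0" and d: "\<delta> = 0"
  shows "lie_isomorphic br (prod_bracket free_nil2_bracket (abelian_bracket :: real \<Rightarrow> _))"
proof -
  \<comment> \<open>The generators go to the \<open>\<xi> i\<close>; the last three entries and
    their signs come from the brackets 12, 13, 23 of the \<open>\<xi> i\<close>, which are
    \<open>- \<phi> 3 Z\<close>, \<open>\<phi> 2 Z\<close> and \<open>- \<phi> 1 Z\<close>. The
    remaining direction \<open>Z\<close> spans the abelian factor.\<close>
  define g where "g x = Xi (vector [x$1, x$2, x$3]) + Phi (vector [- x$6, x$5, - x$4]) Z" for x :: "real^6"
  note p = Phi_H[OF Z_H]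
  show ?thesis
  proof (rule lie_isomorphic_prodI[OF lie, of g "\<lambda>t. t *\<^sub>R Z"])
    show "linear g" by (rule linearI) (simp_all add: g_def Xi_def Phi_def algebra_simps)
    show "linear (\<lambda>t. t *\<^sub>R Z)" by (rule linearI) (simp_all add: algebra_simps)
    show "g (free_nil2_bracket x y) = br (g x) (g y)" for x y
    proof -
      have "br (g x) (g y) = - Phi (cross3 (vector [x$1, x$2, x$3]) (vector [y$1, y$2, y$3])) Z"
        by (simp add: g_def bl br_Xi_Xi d br_Xi_H_0 br_H_Xi_0 p Z_nonzero_H_abelian[OF Z])
      then show ?thesis
        by (simp add: g_def free_nil2_bracket_def table_bracket_simps axis_def
            Xi_def Phi_def cross_components algebra_simps)
    qed
    show "abelian_bracket x y *\<^sub>R Z = br (x *\<^sub>R Z) (y *\<^sub>R Z)" for x y :: real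
      by (simp add: abelian_bracket_def bl alt)
    show "br (g x) (y *\<^sub>R Z) = 0" for x y
      by (simp add: g_def bl br_Xi_H_0 br_Phi_Z Z_H)
    show "\<exists>x y. Y = g x + y *\<^sub>R Z" for Y
    proof -
      obtain x t a where Y: "Y = Xi x + t *\<^sub>R Z + Phi a Z" using coordsE[OF Z_H Z] .
      define w :: "real^6" where "w = x$1 *\<^sub>R axis 1 1 + x$2 *\<^sub>R axis 2 1 + x$3 *\<^sub>R axis 3 1
          - a$3 *\<^sub>R axis 4 1 + a$2 *\<^sub>R axis 5 1 - a$1 *\<^sub>R axis 6 1"
      have "Y = g w + t *\<^sub>R Z"
        by (simp add: Y g_def w_def axis_def Xi_def Phi_def)
      then show ?thesis by blast
    qed
  qed (use dim7 in auto)
qed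

end

section \<open>The case \<open>\<psi> = 0\<close>, \<open>Z = 0\<close>\<close>

definition frame :: "real^3 \<Rightarrow> real^3 \<Rightarrow> real^3 \<Rightarrow> bool" where
  "frame a b c \<longleftrightarrow> a \<bullet> a = 1 \<and> b \<bullet> b = 1 \<and> a \<bullet> b = 0 \<and> c = cross3 a b"

lemma frame_rotate: "frame a b c \<Longrightarrow> frame b c a"
  by (auto simp: frame_def dot_cross dot_cross_self Lagrange inner_commute)

lemma frame_cross:
  assumes "frame a b c"
  shows "cross3 a b = c" "cross3 b c = a" "cross3 c a = b"
    "cross3 b a = - c" "cross3 c b = - a" "cross3 a c = - b"
  using assms frame_rotate[OF assms] frame_rotate[OF frame_rotate[OF assms]]
    cross_skew[of a b] cross_skew[of b c] cross_skew[of c a]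
  by (auto simp: frame_def)

lemma frame_inner:
  assumes "frame a b c"
  shows "a \<bullet> a = 1" "b \<bullet> b = 1" "c \<bullet> c = 1" "a \<bullet> b = 0" "b \<bullet> c = 0" "c \<bullet> a = 0"
    "b \<bullet> a = 0" "c \<bullet> b = 0" "a \<bullet> c = 0"
  using assms frame_rotate[OF assms] frame_rotate[OF frame_rotate[OF assms]]
  by (auto simp: frame_def inner_commute)

text \<open>Evaluate the double cross product of \<open>c\<close> with \<open>x\<close> in two
  ways.\<close>

lemma frame_expand:
  assumes f: "frame a b c"
  shows "x = (x \<bullet> a) *\<^sub>R a + (x \<bullet> b) *\<^sub>R b + (x \<bullet> c) *\<^sub>R c"
proof -
  have "cross3 c x = - cross3 x (cross3 a b)" unfolding frame_cross(1)[OF f] by (rule cross_skew)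
  also have "\<dots> = (x \<bullet> a) *\<^sub>R b - (x \<bullet> b) *\<^sub>R a" by (simp add: Lagrange)
  finally have "cross3 c (cross3 c x) = - (x \<bullet> a) *\<^sub>R a - (x \<bullet> b) *\<^sub>R b"
    by (simp add: Cross3.right_diff_distrib cross_mult_right frame_cross[OF f])
  moreover have "cross3 c (cross3 c x) = (x \<bullet> c) *\<^sub>R c - x"
    by (simp add: Lagrange frame_inner[OF f] inner_commute)
  ultimately show ?thesis by (simp add: algebra_simps)
qed

lemma frame_of_orthogonal:
  assumes "a \<bullet> a = 1" "c \<bullet> c = 1" "a \<bullet> c = 0"
  shows "frame a (cross3 c a) c"
  using assms by (simp add: frame_def dot_cross dot_cross_self Lagrange inner_commute)

lemma frame_exists:
  assumes "c \<bullet> c = 1"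
  obtains a b where "frame a b c"
proof -
  have "c \<noteq> 0" using assms by auto
  then obtain i where n: "cross3 c (axis i 1) \<noteq> 0" using cross_basis_nonzero by blast
  define a where "a = (1 / norm (cross3 c (axis i 1))) *\<^sub>R cross3 c (axis i 1)"
  have "a \<bullet> a = 1" using n by (simp add: a_def dot_square_norm power2_eq_square)
  moreover have "a \<bullet> c = 0" by (simp add: a_def dot_cross_self inner_commute)
  ultimately show thesis using frame_of_orthogonal[OF _ assms] that by blast
qed

text \<open>Again a double cross product with the normal of \<open>a\<close> and \<open>b\<close> is
  evaluated in two ways, now without orthonormality of \<open>a\<close> and
  \<open>b\<close>.\<close>

lemma cross_span:
  assumes "cross3 a b \<noteq> 0"
  obtains r s t where "x = r *\<^sub>R a + s *\<^sub>R b + t *\<^sub>R cross3 a b"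
proof -
  let ?n = "cross3 a b"
  have n: "?n \<bullet> ?n \<noteq> 0" using assms by simp
  have na: "cross3 ?n a = (a \<bullet> a) *\<^sub>R b - (a \<bullet> b) *\<^sub>R a"
    using cross_skew[of ?n a] by (simp add: Lagrange)
  have nb: "cross3 ?n b = (a \<bullet> b) *\<^sub>R b - (b \<bullet> b) *\<^sub>R a"
    using cross_skew[of ?n b] by (simp add: Lagrange inner_commute)
  have nx: "cross3 ?n x = (x \<bullet> a) *\<^sub>R b - (x \<bullet> b) *\<^sub>R a"
    using cross_skew[of ?n x] by (simp add: Lagrange)
  have "cross3 ?n (cross3 ?n x) = (?n \<bullet> x) *\<^sub>R ?n - (?n \<bullet> ?n) *\<^sub>R x" by (rule Lagrange)
  then have "(?n \<bullet> ?n) *\<^sub>R x = (?n \<bullet> x) *\<^sub>R ?n - cross3 ?n (cross3 ?n x)" by simp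
  also have "cross3 ?n (cross3 ?n x)
      = ((x \<bullet> b) * (a \<bullet> b) - (x \<bullet> a) * (b \<bullet> b)) *\<^sub>R a + ((x \<bullet> a) * (a \<bullet> b) - (x \<bullet> b) * (a \<bullet> a)) *\<^sub>R b"
    unfolding nx by (simp add: Cross3.right_diff_distrib cross_mult_right na nb algebra_simps)
  finally have "(?n \<bullet> ?n) *\<^sub>R x = ((x \<bullet> a) * (b \<bullet> b) - (x \<bullet> b) * (a \<bullet> b)) *\<^sub>R a
      + ((x \<bullet> b) * (a \<bullet> a) - (x \<bullet> a) * (a \<bullet> b)) *\<^sub>R b + (?n \<bullet> x) *\<^sub>R ?n"
    by (simp add: algebra_simps)
  then have "(1 / (?n \<bullet> ?n)) *\<^sub>R ((?n \<bullet> ?n) *\<^sub>R x) =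
      (1 / (?n \<bullet> ?n)) *\<^sub>R (((x \<bullet> a) * (b \<bullet> b) - (x \<bullet> b) * (a \<bullet> b)) *\<^sub>R a
      + ((x \<bullet> b) * (a \<bullet> a) - (x \<bullet> a) * (a \<bullet> b)) *\<^sub>R b + (?n \<bullet> x) *\<^sub>R ?n)" by (rule arg_cong)
  then have "x = (((x \<bullet> a) * (b \<bullet> b) - (x \<bullet> b) * (a \<bullet> b)) / (?n \<bullet> ?n)) *\<^sub>R a
      + (((x \<bullet> b) * (a \<bullet> a) - (x \<bullet> a) * (a \<bullet> b)) / (?n \<bullet> ?n)) *\<^sub>R b + ((?n \<bullet> x) / (?n \<bullet> ?n)) *\<^sub>R ?n"
    using n by (simp add: scaleR_right_distrib)
  then show thesis by (rule that)
qed

section \<open>Vanishing psi and Z: the complex affine algebra\<close>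

locale psi_Z_zero = psi_zero +
  assumes Z_zero: "Z = 0"
begin

lemma br_Xi: "br (Xi a) (Xi b) = (2 * \<delta>) *\<^sub>R Xi (cross3 a b)"
  by (simp add: br_Xi_Xi Z_zero lin_XP)

lemma br_Xi_br_H: "X \<in> H \<Longrightarrow> Y \<in> H \<Longrightarrow> br (Xi a) (br X Y) = 0"
  by (simp add: jacobi[of "Xi a" X Y] br_Xi_H_0 bl)

text \<open>With \<open>Z\<close> = 0 the vertical space is a subalgebra, abelian for \<delta> = 0
  and so(3) otherwise; one commuting complement serves both cases.\<close>

lemma commuting_factor_iso:
  assumes g: "linear g" "\<And>x y :: real^4. g (br2 x y) = br (g x) (g y)"
    and c: "\<And>a y. br (Xi a) (g y) = 0" and s: "\<And>Y. \<exists>x y. Y = Xi x + g y"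
  shows "lie_isomorphic br (prod_bracket (abelian_bracket :: real^3 \<Rightarrow> _) br2) \<or>
    lie_isomorphic br (prod_bracket so3_bracket br2)"
proof (cases "\<delta> = 0")
  case True
  have "lie_isomorphic br (prod_bracket (abelian_bracket :: real^3 \<Rightarrow> _) br2)"
    by (rule lie_isomorphic_prodI[OF lie _ linear_Xi g(1) _ g(2) c s])
       (simp_all add: dim7 abelian_bracket_def br_Xi True lin_XP)
  then show ?thesis ..
next
  case False
  have "lie_isomorphic br (prod_bracket so3_bracket br2)"
    by (rule lie_isomorphic_so3_prodI[OF lie _ linear_Xi g(1) br_Xi g(2) c s False]) (simp add: dim7)
  then show ?thesis ..
qed

lemma aff_C_factor:
  assumes X: "X \<in> H" and f: "frame e1 e2 e3" and \<sigma>: "\<sigma> \<noteq> 0"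
    and u1: "br X (Phi e1 X) = Xi w1 + \<sigma> *\<^sub>R X"
    and u2: "br X (Phi e2 X) = Xi w2 - \<sigma> *\<^sub>R Phi e3 X"
    and u3: "br X (Phi e3 X) = 0"
    and X0: "X \<noteq> 0"
  shows "lie_isomorphic br (prod_bracket (abelian_bracket :: real^3 \<Rightarrow> _) aff_C_bracket) \<or>
    lie_isomorphic br (prod_bracket so3_bracket aff_C_bracket)"
proof -
  note pH = Phi_H[OF X]
  \<comment> \<open>\<open>E3\<close> and \<open>E4\<close> are chosen as bracket values, so they
    are \<open>X\<close> and \<open>Phi e3 X\<close> up to vertical terms, which commute with
    \<open>H\<close>. The signs and the factor 1/\<sigma> make \<open>E1\<close> act on both as the
    identity and \<open>E2\<close> as a complex structure.\<close>
  define E1 where "E1 = - (1 / \<sigma>) *\<^sub>R Phi e1 X"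
  define E2 where "E2 = (1 / \<sigma>) *\<^sub>R Phi e2 X"
  define E3 where "E3 = (1 / \<sigma>) *\<^sub>R br X (Phi e1 X)"
  define E4 where "E4 = - (1 / \<sigma>) *\<^sub>R br X (Phi e2 X)"
  note P = br_Phi_Phi[OF X] frame_cross[OF f]
  have swX: "br (Phi a X) X = - br X (Phi a X)" for a by (rule swap)
  have E3: "E3 = X + (1 / \<sigma>) *\<^sub>R Xi w1" and E4: "E4 = Phi e3 X - (1 / \<sigma>) *\<^sub>R Xi w2"
    using \<sigma> by (simp_all add: E3_def E4_def u1 u2 scaleR_right_distrib scaleR_right_diff_distrib)
  have c1: "br (Xi a) E1 = 0" "br (Xi a) E2 = 0" "br (Xi a) E3 = 0" "br (Xi a) E4 = 0" for a
    by (simp_all add: E1_def E2_def E3_def E4_def bl br_Xi_H_0 pH br_Xi_br_H X)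
  have c2: "br E1 (Xi a) = 0" "br E2 (Xi a) = 0" "br E3 (Xi a) = 0" "br E4 (Xi a) = 0" for a
    using c1[of a] swap[of _ "Xi a"] by auto
  have t12: "br E1 E2 = 0"
    by (simp add: E1_def E2_def bl P u3)
  have t13: "br E1 E3 = E3"
    unfolding E3(1) using c2(1) \<sigma> by (simp add: bl) (simp add: E1_def bl swX u1 algebra_simps)
  have t14: "br E1 E4 = E4"
    unfolding E4 using c2(1) \<sigma> by (simp add: bl) (simp add: E1_def bl P u2 lin_XP scaleR_right_diff_distrib)
  have t23: "br E2 E3 = E4"
    unfolding E3 using c2(2) \<sigma> by (simp add: bl) (simp add: E2_def E4_def bl swX)
  have t24: "br E2 E4 = - E3"
    unfolding E4 using c2(2) \<sigma> by (simp add: bl) (simp add: E2_def E3_def bl P lin_XP)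
  have t34: "br E3 E4 = 0"
    unfolding E4 using c2(3) by (simp add: bl) (simp add: E3 bl u3 br_Xi_H_0 pH)
  note t = t12 t13 t14 t23 t24 t34
  define g where "g y = y$1 *\<^sub>R E1 + y$2 *\<^sub>R E2 + y$3 *\<^sub>R E3 + y$4 *\<^sub>R E4" for y :: "real^4"
  have sw: "br E2 E1 = 0" "br E3 E1 = - E3" "br E4 E1 = - E4" "br E3 E2 = - E4" "br E4 E2 = E3"
    "br E4 E3 = 0"
    using t swap[of E2 E1] swap[of E3 E1] swap[of E4 E1] swap[of E3 E2] swap[of E4 E2] swap[of E4 E3]
    by simp_all
  show ?thesis
  proof (rule commuting_factor_iso[of g])
    show "linear g" by (rule linearI) (simp_all add: g_def algebra_simps)
    show "g (aff_C_bracket x y) = br (g x) (g y)" for x y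
      by (simp add: g_def bl t sw alt aff_C_bracket_def table_bracket_simps axis_def algebra_simps)
    show "br (Xi a) (g y) = 0" for a y by (simp add: g_def bl c1)
    show "\<exists>x y. Y = Xi x + g y" for Y
    proof -
      obtain x t a where Y: "Y = Xi x + t *\<^sub>R X + Phi a X" using coordsE[OF X X0] .
      have a: "Phi a X = (a \<bullet> e1) *\<^sub>R Phi e1 X + (a \<bullet> e2) *\<^sub>R Phi e2 X + (a \<bullet> e3) *\<^sub>R Phi e3 X"
        by (subst frame_expand[OF f, of a]) (simp only: lin_XP)
      define y :: "real^4" where "y = - (\<sigma> * (a \<bullet> e1)) *\<^sub>R axis 1 1 + (\<sigma> * (a \<bullet> e2)) *\<^sub>R axis 2 1
        + t *\<^sub>R axis 3 1 + (a \<bullet> e3) *\<^sub>R axis 4 1"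
      \<comment> \<open>The terms in \<open>w1\<close> and \<open>w2\<close> undo the vertical
        shifts in \<open>E3\<close> and \<open>E4\<close>.\<close>
      have "Y = Xi (x - (t / \<sigma>) *\<^sub>R w1 + ((a \<bullet> e3) / \<sigma>) *\<^sub>R w2) + g y"
        using \<sigma> unfolding Y a
        by (simp add: g_def y_def axis_def E1_def E2_def E3 E4 lin_XP algebra_simps)
      then show ?thesis by blast
    qed
  qed
qed

text \<open>The coefficient of \<open>X\<close> is a linear functional of \<open>a\<close>; its
  representing vector \<open>S\<close> is the adjoint evaluated at 1.\<close>

lemma H_bracket_coordsE:
  assumes X: "X \<in> H" "X \<noteq> 0"
  obtains f w S where "linear f" "\<And>a. br X (Phi a X) = Xi (w a) + (S \<bullet> a) *\<^sub>R X + Phi (f a) X"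
proof -
  define G where "G = (\<lambda>(x, t, a). Xi x + t *\<^sub>R X + Phi a X)"
  have G: "linear G" "bij G" unfolding G_def using linear_coords bij_coords[OF X] by blast+
  define k where "k = inv G"
  have Gk: "G (k Y) = Y" for Y unfolding k_def by (rule surj_f_inv_f[OF bij_is_surj[OF G(2)]])
  have k: "linear k"
    by (rule linearI; rule injD[OF bij_is_inj[OF G(2)]])
       (simp_all add: Gk linear_add[OF G(1)] linear_scale[OF G(1)])
  let ?u = "\<lambda>a. k (br X (Phi a X))"
  have u: "linear ?u"
    by (rule linearI) (simp_all add: lin_XP bl linear_add[OF k] linear_scale[OF k])
  have "linear (\<lambda>a. snd (snd (?u a)))" "linear (\<lambda>a. fst (snd (?u a)))"
    by (rule linearI; simp add: linear_add[OF u] linear_scale[OF u])+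
  note l = this
  have "adjoint (\<lambda>a. fst (snd (?u a))) 1 \<bullet> a = fst (snd (?u a))" for a
    using adjoint_works[OF l(2), of a 1] by (simp add: inner_commute)
  moreover have "br X (Phi a X) = Xi (fst (?u a)) + fst (snd (?u a)) *\<^sub>R X + Phi (snd (snd (?u a))) X" for a
    using Gk[of "br X (Phi a X)"] by (simp add: G_def case_prod_beta)
  ultimately show thesis
    using that[OF l(1), of "\<lambda>a. fst (?u a)" "adjoint (\<lambda>a. fst (snd (?u a))) 1"] by simp
qed

lemma coords_unique:
  assumes X: "X \<in> H" "X \<noteq> 0" and e: "Xi x + s *\<^sub>R X + Phi a X = Xi x' + s' *\<^sub>R X + Phi a' X"
  shows "x = x'" "s = s'" "a = a'"
  using injD[OF bij_is_inj[OF bij_coords[OF X]], of "(x, s, a)" "(x', s', a')"] e by auto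

text \<open>Write \<open>u a = [X, Phi a X] = Xi (w a) + (S \<bullet> a) X + Phi (f a) X\<close>.
  The vector \<open>X\<close> is chosen in the horizontal part of the image of \<open>u\<close>, which forces
  \<open>S \<noteq> 0\<close>. The Jacobi identities \<open>A\<close> and \<open>B\<close> then yield a kernel vector \<open>k\<close>
  of \<open>u\<close> orthogonal to \<open>S\<close>, and in the frame with first axis along \<open>S\<close> and third axis
  along \<open>k\<close> they determine all entries of \<open>f\<close>.\<close>

lemma nonvertical_frame:
  assumes nv: "X1 \<in> H" "Y1 \<in> H" "br X1 Y1 \<notin> range Xi"
  obtains X e1 e2 e3 \<sigma> w1 w2 where "X \<in> H" "X \<noteq> 0" "frame e1 e2 e3" "\<sigma> \<noteq> 0"
    "br X (Phi e1 X) = Xi w1 + \<sigma> *\<^sub>R X" "br X (Phi e2 X) = Xi w2 - \<sigma> *\<^sub>R Phi e3 X"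
    "br X (Phi e3 X) = 0"
proof -
  obtain w0 X where w0: "br X1 Y1 = Xi w0 + X" and XH: "X \<in> H" using Xi_H_decompE .
  have X0: "X \<noteq> 0" using nv(3) w0 by auto
  note X = XH X0
  define u where "u a = br X (Phi a X)" for a
  have u: "linear u" unfolding u_def by (rule linearI) (simp_all add: lin_XP bl)
  note lu = linear_add[OF u] linear_scale[OF u] linear_neg[OF u] linear_diff[OF u] linear_0[OF u]
  obtain f w S where f: "linear f" and uc: "\<And>a. u a = Xi (w a) + (S \<bullet> a) *\<^sub>R X + Phi (f a) X"
    by (rule H_bracket_coordsE[OF X, folded u_def]) (rule that)
  note lf = linear_add[OF f] linear_scale[OF f] linear_neg[OF f] linear_diff[OF f] linear_0[OF f]
  note uniq = coords_unique[OF X]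
  have ker: "S \<bullet> a = 0 \<and> f a = 0" if "u a = 0" for a
    using uniq[of "w a" "S \<bullet> a" "f a" 0 0 0] that uc[of a] by (simp add: lin_XP)
  have PP: "br (Phi a X) (Phi b X) = - u (cross3 a b)" for a b
    unfolding u_def by (rule br_Phi_Phi[OF XH])
  have PX: "br (Phi a X) X = - u a" for a unfolding u_def by (rule swap)
  have Xu: "br X (u a) = u (f a)" for a
    by (subst uc) (simp add: bl br_H_Xi_0 XH alt u_def)
  have Pu: "br (Phi b X) (u a) = - ((S \<bullet> a) *\<^sub>R u b) - u (cross3 b (f a))" for a b
    by (subst uc) (simp add: bl br_H_Xi_0 Phi_H XH PX PP)
  \<comment> \<open>Jacobi identity for \<open>X\<close>, \<open>Phi a X\<close>,
    \<open>Phi b X\<close>.\<close>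
  have A: "u (f (cross3 a b) + (S \<bullet> a) *\<^sub>R b - (S \<bullet> b) *\<^sub>R a + cross3 b (f a) - cross3 a (f b)) = 0" for a b
  proof -
    have "br X (br (Phi a X) (Phi b X)) = br (u a) (Phi b X) + br (Phi a X) (u b)"
      unfolding u_def by (rule jacobi)
    moreover have "br (u a) (Phi b X) = - br (Phi b X) (u a)" by (rule swap)
    ultimately show ?thesis by (simp add: PP Pu bl Xu lu algebra_simps)
  qed
  \<comment> \<open>Jacobi identity for the three vectors \<open>Phi a X\<close>,
    \<open>Phi b X\<close>, \<open>Phi c X\<close> of a frame.\<close>
  have B: "u ((S \<bullet> a) *\<^sub>R a + (S \<bullet> b) *\<^sub>R b + (S \<bullet> c) *\<^sub>R c + cross3 a (f a) + cross3 b (f b) + cross3 c (f c)) = 0"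
    if fr: "frame a b c" for a b c
  proof -
    have "br (Phi a X) (br (Phi b X) (Phi c X)) =
        br (br (Phi a X) (Phi b X)) (Phi c X) + br (Phi b X) (br (Phi a X) (Phi c X))"
      by (rule jacobi)
    moreover have "br (u c) (Phi c X) = - br (Phi c X) (u c)" by (rule swap)
    ultimately show ?thesis
      by (simp add: PP frame_cross[OF fr] Pu bl lu eq_neg_iff_add_eq_0 algebra_simps)
  qed
  \<comment> \<open>By \<open>br_H\<close> the given bracket is a value of \<open>u\<close>, and its
    horizontal part is exactly \<open>X\<close>.\<close>
  obtain a0 where a0: "S \<bullet> a0 = 1" "f a0 = 0"
  proof -
    obtain s a where 1: "X1 = s *\<^sub>R X + Phi a X" using H_coordsE[OF X nv(1)] .
    obtain t b where 2: "Y1 = t *\<^sub>R X + Phi b X" using H_coordsE[OF X nv(2)] .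
    let ?a = "s *\<^sub>R b - t *\<^sub>R a - cross3 a b"
    have "br X1 Y1 = u ?a" unfolding 1 2 u_def by (rule br_H[OF XH])
    then have "Xi (w ?a) + (S \<bullet> ?a) *\<^sub>R X + Phi (f ?a) X = Xi w0 + 1 *\<^sub>R X + Phi 0 X"
      using w0 uc[of ?a] by (simp add: lin_XP)
    from uniq[OF this] show thesis using that by blast
  qed
  define \<sigma> where "\<sigma> = norm S"
  define e1 where "e1 = (1 / \<sigma>) *\<^sub>R S"
  have \<sigma>: "\<sigma> \<noteq> 0" using a0 by (auto simp: \<sigma>_def)
  have S: "S = \<sigma> *\<^sub>R e1" using \<sigma> by (simp add: e1_def)
  have e11: "e1 \<bullet> e1 = 1" using \<sigma> by (simp add: e1_def dot_square_norm \<sigma>_def power2_eq_square)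
  \<comment> \<open>If \<open>u\<close> were injective, it could be dropped from \<open>A\<close>;
    two components of \<open>A\<close> in a frame starting with \<open>e1\<close> then differ by
    2\<sigma>, although both vanish.\<close>
  have "\<exists>k. k \<noteq> 0 \<and> u k = 0"
  proof (rule ccontr)
    assume "\<nexists>k. k \<noteq> 0 \<and> u k = 0"
    then have inj: "x = 0" if "u x = 0" for x using that by blast
    obtain a b where "frame a b e1" using frame_exists[OF e11] .
    then have fr: "frame e1 a b" by (rule frame_rotate[OF frame_rotate])
    note fi = frame_inner[OF fr] frame_cross[OF fr]
    have "(f b + \<sigma> *\<^sub>R a + cross3 a (f e1) - cross3 e1 (f a)) \<bullet> a = 0"
      using inj[OF A[of e1 a]] by (simp add: S fi)
    then have 1: "f b \<bullet> a + \<sigma> + b \<bullet> f a = 0"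
      using cross_triple[of e1 "f a" a] cross_triple[of "f a" a e1]
      by (simp add: inner_add_left inner_diff_left fi dot_cross_self)
    have "(f a - \<sigma> *\<^sub>R b + cross3 e1 (f b) - cross3 b (f e1)) \<bullet> b = 0"
      using inj[OF A[of b e1]] by (simp add: S fi)
    then have 2: "f a \<bullet> b - \<sigma> + a \<bullet> f b = 0"
      using cross_triple[of e1 "f b" b] cross_triple[of "f b" b e1]
      by (simp add: inner_add_left inner_diff_left fi dot_cross_self)
    show False using 1 2 \<sigma> by (simp add: inner_commute)
  qed
  then obtain k where k: "k \<noteq> 0" "u k = 0" by blast
  define e3 where "e3 = (1 / norm k) *\<^sub>R k"
  have u3: "u e3 = 0" by (simp add: e3_def lu k)
  have f3: "f e3 = 0" and S3: "S \<bullet> e3 = 0" using ker[OF u3] by auto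
  have "e3 \<bullet> e3 = 1" using k by (simp add: e3_def dot_square_norm power2_eq_square)
  moreover have "e1 \<bullet> e3 = 0" using S3 \<sigma> by (simp add: S)
  ultimately obtain e2 where fr: "frame e1 e2 e3" using frame_of_orthogonal e11 by blast
  note fi = frame_inner[OF fr] frame_cross[OF fr]
  \<comment> \<open>The kernel of \<open>u\<close> is orthogonal to \<open>S\<close>. Hence the
    \<open>e1\<close> components of \<open>A\<close> and \<open>B\<close> vanish, which yields the
    next four relations between entries of \<open>f\<close>.\<close>
  have K: "e1 \<bullet> x = 0" if "u x = 0" for x using ker[OF that] \<sigma> by (simp add: S)
  have m11: "e1 \<bullet> f e1 = e2 \<bullet> f e2"
    using K[OF A[of e2 e3]] cross_triple[of e3 "f e2" e1] cross_triple[of "f e2" e1 e3]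
    by (simp add: S fi f3 inner_add_right inner_diff_right inner_commute)
  have m12: "e1 \<bullet> f e2 = - (e2 \<bullet> f e1)"
    using K[OF A[of e3 e1]] cross_triple[of e3 "f e1" e1] cross_triple[of "f e1" e1 e3]
    by (simp add: S fi f3 inner_add_right inner_diff_right inner_commute)
  have m31: "e3 \<bullet> f e1 = 0"
    using K[OF A[of e1 e2]] cross_triple[of e2 "f e1" e1] cross_triple[of "f e1" e1 e2]
    by (simp add: S fi f3 inner_add_right inner_diff_right inner_commute dot_cross_self)
  have m32: "e3 \<bullet> f e2 = - \<sigma>"
    using K[OF B[OF fr]] cross_triple[of e2 "f e2" e1] cross_triple[of "f e2" e1 e2]
    by (simp add: S fi f3 inner_add_right inner_diff_right inner_commute dot_cross_self)
  \<comment> \<open>The \<open>e3\<close> component of \<open>f a0 = 0\<close> kills the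
    \<open>e2\<close> coordinate of \<open>a0\<close>, while \<open>S \<bullet> a0 = 1\<close> keeps
    its \<open>e1\<close> coordinate nonzero; therefore \<open>f e1\<close> vanishes.\<close>
  define y where "y = a0 \<bullet> e2"
  have "f ((a0 \<bullet> e1) *\<^sub>R e1 + (a0 \<bullet> e2) *\<^sub>R e2 + (a0 \<bullet> e3) *\<^sub>R e3) = 0"
    using a0(2) by (simp only: frame_expand[OF fr, of a0, symmetric])
  then have fa: "(a0 \<bullet> e1) *\<^sub>R f e1 + y *\<^sub>R f e2 = 0" by (simp add: lf f3 y_def)
  then have "e3 \<bullet> ((a0 \<bullet> e1) *\<^sub>R f e1 + y *\<^sub>R f e2) = 0" by simp
  then have "y = 0" using \<sigma> by (simp add: inner_add_right m31 m32)
  moreover have "a0 \<bullet> e1 \<noteq> 0" using a0(1) by (auto simp: S inner_commute)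
  ultimately have f1: "f e1 = 0" using fa by simp
  have "f e2 = (f e2 \<bullet> e1) *\<^sub>R e1 + (f e2 \<bullet> e2) *\<^sub>R e2 + (f e2 \<bullet> e3) *\<^sub>R e3"
    by (rule frame_expand[OF fr])
  then have f2: "f e2 = - \<sigma> *\<^sub>R e3" using m11 m12 m32 by (simp add: f1 inner_commute)
  have "u e1 = Xi (w e1) + \<sigma> *\<^sub>R X" "u e2 = Xi (w e2) - \<sigma> *\<^sub>R Phi e3 X"
    using uc[of e1] uc[of e2] by (simp_all add: f1 f2 S fi lin_XP)
  then show thesis using that X fr \<sigma> u3 unfolding u_def by blast
qed

section \<open>Horizontal brackets with vertical values: so(3) and the nilpotent models\<close>

lemma vertical_bracket_so3:
  assumes v: "\<And>X Y. X \<in> H \<Longrightarrow> Y \<in> H \<Longrightarrow> br X Y \<in> range Xi" and d: "\<delta> \<noteq> 0"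
  shows "lie_isomorphic br (prod_bracket so3_bracket (abelian_bracket :: real^4 \<Rightarrow> _))"
proof (rule so3_times_abelian[OF _ d])
  fix X Y assume XY: "X \<in> H" "Y \<in> H"
  obtain x where x: "br X Y = Xi x" using v[OF XY] by blast
  \<comment> \<open>The bracket is vertical and commutes with all vertical vectors, and for \<delta>
    nonzero the vertical algebra has trivial centre.\<close>
  have "x = 0" using Xi_central_0[OF _ d] br_Xi_br_H[OF XY] x by metis
  then show "br X Y = 0" using x by (simp add: lin_XP)
qed

lemma br_zero_of_H_abelian:
  assumes d: "\<delta> = 0" and X: "X \<in> H" "X \<noteq> 0" and 0: "\<And>a. br X (Phi a X) = 0"
  shows "br Y Y' = 0"
proof -
  obtain x t a where Y: "Y = Xi x + (t *\<^sub>R X + Phi a X)" using coordsE[OF X] by (metis add.assoc)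
  obtain x' t' a' where Y': "Y' = Xi x' + (t' *\<^sub>R X + Phi a' X)" using coordsE[OF X] by (metis add.assoc)
  have "t *\<^sub>R X + Phi a X \<in> H" "t' *\<^sub>R X + Phi a' X \<in> H"
    using X by (simp_all add: Phi_H subspace_H subspace_add subspace_scale)
  then have "br Y Y' = br (t *\<^sub>R X + Phi a X) (t' *\<^sub>R X + Phi a' X)"
    unfolding Y Y' bilinear_ladd[OF bil, of "Xi x"] bilinear_radd[OF bil, of _ "Xi x'"]
    by (simp add: br_Xi d br_Xi_H_0 br_H_Xi_0)
  also have "\<dots> = 0" by (simp add: br_H[OF X(1)] 0)
  finally show ?thesis .
qed

text \<open>Brackets are governed by a linear map \<open>w\<close> of three-space. Rank 3, 2 and 1
  give the quaternionic, complex and real Heisenberg models; rank 0 would make the algebra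
  abelian.\<close>

lemma nilpotent_cases:
  assumes v: "\<And>X Y. X \<in> H \<Longrightarrow> Y \<in> H \<Longrightarrow> br X Y \<in> range Xi" and d: "\<delta> = 0"
    and na: "\<exists>x y. br x y \<noteq> 0"
  shows "lie_isomorphic br (prod_bracket heis5_bracket (abelian_bracket :: real^2 \<Rightarrow> _)) \<or>
        lie_isomorphic br (prod_bracket heis3_C_bracket (abelian_bracket :: real \<Rightarrow> _)) \<or>
        lie_isomorphic br heis7_H_bracket"
proof -
  obtain X where X: "X \<in> H" "X \<noteq> 0" using H_nonzero .
  have "\<forall>a. \<exists>x. br X (Phi a X) = Xi x" using v[OF X(1) Phi_H[OF X(1)]] by blast
  then obtain w where w: "\<And>a. br X (Phi a X) = Xi (w a)" by metis
  have injXi: "x = y" if "Xi x = Xi y" for x y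
    using Xi_H_eq_0(1)[of "x - y" 0] that by (simp add: lin_XP subspace_0[OF subspace_H])
  have lw: "linear w"
    by (rule linearI; rule injXi) (simp_all add: lin_XP bl flip: w)
  note lw' = linear_add[OF lw] linear_scale[OF lw] linear_neg[OF lw] linear_diff[OF lw] linear_0[OF lw]
  have XX: "br (Xi a) (Xi b) = 0" for a b by (simp add: br_Xi d)
  have HB: "br (Xi x + (s *\<^sub>R X + Phi a X)) (Xi y + (t *\<^sub>R X + Phi b X))
      = Xi (w (s *\<^sub>R b - t *\<^sub>R a - cross3 a b))" for x y s t a b
  proof -
    have "t *\<^sub>R X + Phi b X \<in> H" "s *\<^sub>R X + Phi a X \<in> H"
      using X by (simp_all add: Phi_H subspace_H subspace_add subspace_scale)
    then show ?thesis
      unfolding bilinear_ladd[OF bil, of "Xi x"] bilinear_radd[OF bil, of _ "Xi y"]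
      by (simp add: XX br_Xi_H_0 br_H_Xi_0 br_H[OF X(1)] w)
  qed
  have HB0: "br (Xi x) (Xi y + (t *\<^sub>R X + Phi b X)) = 0"
    "br (Xi x + (s *\<^sub>R X + Phi a X)) (Xi y) = 0" for x y s t a b
    using HB[of x 0 0 y t b] HB[of x s a y 0 0] by (simp_all add: lin_XP lw')
  show ?thesis
  proof (cases "inj w")
    case True
    have "surj w" using linear_inj_imp_surj[OF lw] True by blast
    \<comment> \<open>The basis vectors \<tau> go to \<open>X\<close>, \<open>- \<phi> 2 X\<close>,
      \<open>- \<phi> 1 X\<close>, \<open>- \<phi> 3 X\<close> in this order, and the central basis
      goes through \<open>- w\<close>, matching the signs of the table.\<close>
    define g where "g x = Xi (- w (vector [x$1, x$2, x$3])) +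
      (x$4 *\<^sub>R X + Phi (- vector [x$6, x$5, x$7]) X)" for x :: "real^7"
    have lv: "vector [a + b, c + d, e + f] = vector [a, c, e] + (vector [b, d, f] :: real^3)"
      "vector [r * a, r * c, r * e] = r *\<^sub>R (vector [a, c, e] :: real^3)" for a b c d e f r :: real
      by (simp_all add: vec_eq_iff forall_3)
    have "lie_isomorphic br heis7_H_bracket"
    proof (rule lie_isomorphicI[of g])
      show "linear g"
        by (rule linearI) (simp_all add: g_def lv lw' lin_XP algebra_simps)
      show "surj g" unfolding surj_def
      proof
        fix Y obtain x t a where Y: "Y = Xi x + (t *\<^sub>R X + Phi a X)" using coordsE[OF X] by (metis add.assoc)
        obtain y where y: "- x = w y" using \<open>surj w\<close> by (metis surjD)
        define z :: "real^7" where "z = y$1 *\<^sub>R axis 1 1 + y$2 *\<^sub>R axis 2 1 + y$3 *\<^sub>R axis 3 1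
          + t *\<^sub>R axis 4 1 - a$2 *\<^sub>R axis 5 1 - a$1 *\<^sub>R axis 6 1 - a$3 *\<^sub>R axis 7 1"
        have "vector [z$1, z$2, z$3] = y" "z $ 4 = t" "- vector [z$6, z$5, z$7] = a"
          by (simp_all add: z_def axis_def vec_eq_iff forall_3)
        then have "Y = g z" by (simp add: g_def Y flip: y)
        then show "\<exists>z. Y = g z" by blast
      qed
      show "DIM(real^7) = dim (UNIV :: 'a set)" by (simp add: dim7)
      show "g (heis7_H_bracket x y) = br (g x) (g y)" for x y
      proof -
        let ?z = "heis7_H_bracket x y"
        have z: "?z $ 4 = 0" "- vector [?z$6, ?z$5, ?z$7] = (0 :: real^3)"
          "vector [?z$1, ?z$2, ?z$3] = - (x$4 *\<^sub>R - vector [y$6, y$5, y$7]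
            - y$4 *\<^sub>R - vector [x$6, x$5, x$7] -
              cross3 (- vector [x$6, x$5, x$7]) (- vector [y$6, y$5, y$7]) :: real^3)"
          by (simp_all add: heis7_H_bracket_def table_bracket_simps axis_def vec_eq_iff forall_3
              cross_components algebra_simps)
        show ?thesis unfolding g_def HB unfolding z by (simp add: lw' lin_XP)
      qed
    qed
    then show ?thesis by blast
  next
    case False
    then obtain k where k: "k \<noteq> 0" "w k = 0" unfolding linear_injective_0[OF lw] by blast
    define e3 where "e3 = (1 / norm k) *\<^sub>R k"
    have e3: "e3 \<bullet> e3 = 1" "w e3 = 0"
      using k by (simp_all add: e3_def dot_square_norm power2_eq_square lw')
    obtain e1 e2 where fr: "frame e1 e2 e3" using frame_exists[OF e3(1)] .
    show ?thesis
    \<comment> \<open>As \<open>w e3 = 0\<close>, a linear dependence of \<open>w e1\<close> and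
      \<open>w e2\<close> distinguishes rank at most 1 from rank 2.\<close>
    proof (cases "\<exists>c1 c2. (c1 \<noteq> 0 \<or> c2 \<noteq> 0) \<and> c1 *\<^sub>R w e1 + c2 *\<^sub>R w e2 = 0")
      case True
      then obtain c1 c2 where c: "c1 \<noteq> 0 \<or> c2 \<noteq> 0" "c1 *\<^sub>R w e1 + c2 *\<^sub>R w e2 = 0" by blast
      let ?b = "c1 *\<^sub>R e1 + c2 *\<^sub>R e2"
      define b where "b = (1 / norm ?b) *\<^sub>R ?b"
      have "?b \<bullet> ?b = c1 * c1 + c2 * c2"
        by (simp add: inner_add_left inner_add_right frame_inner[OF fr])
      then have "?b \<bullet> ?b \<noteq> 0" using c(1) by (simp add: sum_squares_eq_zero_iff)
      then have "b \<bullet> b = 1" by (simp add: b_def dot_square_norm power2_eq_square)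
      moreover have "b \<bullet> e3 = 0" by (simp add: b_def inner_add_left frame_inner[OF fr])
      ultimately have "frame b (cross3 e3 b) e3" using frame_of_orthogonal e3(1) by blast
      then obtain a where fr': "frame a e3 b" using frame_rotate by blast
      have wb: "w b = 0" using c(2) by (simp add: b_def lw')
      have "w a \<noteq> 0"
      proof
        assume "w a = 0"
        then have "w x = 0" for x
          by (subst frame_expand[OF fr', of x]) (simp only: lw' wb e3 scaleR_zero_right add_0_left)
        then have "br X (Phi x X) = 0" for x by (simp add: w lin_XP)
        then show False using br_zero_of_H_abelian[OF d X] na by blast
      qed
      define n where "n = (1 / norm (w a)) *\<^sub>R w a"
      have n: "n \<bullet> n = 1" "norm (w a) *\<^sub>R n = w a"
        using \<open>w a \<noteq> 0\<close> by (simp_all add: n_def dot_square_norm power2_eq_square)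
      obtain p q where pq: "frame p q n" using frame_exists[OF n(1)] .
      note fc = frame_cross[OF fr']
      \<comment> \<open>Only \<open>w a\<close> survives, so \<open>X\<close>,
        \<open>Phi a X\<close> and \<open>Phi b X\<close>, \<open>Phi e3 X\<close> are the two
        Heisenberg pairs; the orthogonal complement of \<open>w a\<close> supplies the abelian
        factor.\<close>
      define g where "g x = Xi (x$5 *\<^sub>R w a) + (x$1 *\<^sub>R X +
          Phi (x$2 *\<^sub>R a + x$3 *\<^sub>R b + x$4 *\<^sub>R e3) X)" for x :: "real^5"
      define h where "h y = Xi (y$1 *\<^sub>R p + y$2 *\<^sub>R q)" for y :: "real^2"
      have "lie_isomorphic br (prod_bracket heis5_bracket (abelian_bracket :: real^2 \<Rightarrow> _))"
      proof (rule lie_isomorphic_prodI[OF lie, of g h])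
        show "linear g" "linear h"
          by (rule linearI; simp add: g_def h_def lin_XP algebra_simps)+
        show "g (heis5_bracket x y) = br (g x) (g y)" for x y
        proof -
          have "br (g x) (g y) = Xi ((x$1 * y$2 - y$1 * x$2 + x$3 * y$4 - x$4 * y$3) *\<^sub>R w a)"
            unfolding g_def HB
            by (simp add: cross_add_left cross_add_right cross_mult_left cross_mult_right fc
                lw' wb e3 algebra_simps)
          then show ?thesis
            by (simp add: g_def heis5_bracket_def table_bracket_simps axis_def lin_XP algebra_simps)
        qed
        show "h (abelian_bracket x y) = br (h x) (h y)" for x y
          by (simp only: h_def abelian_bracket_def XX) (simp add: lin_XP)
        show "br (g x) (h y) = 0" for x y unfolding g_def h_def by (rule HB0)
        show "\<exists>x y. Y = g x + h y" for Y
        proof -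
          obtain x t c where Y: "Y = Xi x + t *\<^sub>R X + Phi c X" using coordsE[OF X] .
          define y :: "real^2" where "y = (x \<bullet> p) *\<^sub>R axis 1 1 + (x \<bullet> q) *\<^sub>R axis 2 1"
          define z :: "real^5" where "z = t *\<^sub>R axis 1 1 + (c \<bullet> a) *\<^sub>R axis 2 1 + (c \<bullet> b) *\<^sub>R axis 3 1
             + (c \<bullet> e3) *\<^sub>R axis 4 1 + ((x \<bullet> n) / norm (w a)) *\<^sub>R axis 5 1"
          have c: "Phi c X = (c \<bullet> a) *\<^sub>R Phi a X + (c \<bullet> e3) *\<^sub>R Phi e3 X + (c \<bullet> b) *\<^sub>R Phi b X"
            by (subst frame_expand[OF fr', of c]) (simp only: lin_XP)
          have x: "Xi x = (x \<bullet> p) *\<^sub>R Xi p + (x \<bullet> q) *\<^sub>R Xi q + ((x \<bullet> n) / norm (w a)) *\<^sub>R Xi (w a)"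
            by (subst frame_expand[OF pq, of x]) (simp add: lin_XP n_def)
          have "Y = g z + h y"
            unfolding Y c x by (simp add: g_def h_def z_def y_def axis_def lin_XP)
          then show ?thesis by blast
        qed
      qed (simp add: dim7)
      then show ?thesis by blast
    next
      case False
      then have indep: "c1 = 0 \<and> c2 = 0" if "c1 *\<^sub>R w e1 + c2 *\<^sub>R w e2 = 0" for c1 c2 using that by blast
      define n where "n = cross3 (w e1) (w e2)"
      have "n \<noteq> 0"
      proof
        assume "n = 0"
        then have "cross3 (w e1) (cross3 (w e1) (w e2)) = 0" by (simp add: n_def)
        then have "(w e1 \<bullet> w e2) *\<^sub>R w e1 + (- (w e1 \<bullet> w e1)) *\<^sub>R w e2 = 0"
          by (simp add: Lagrange)
        from indep[OF this] have "w e1 = 0" by simp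
        then show False using indep[of 1 0] by simp
      qed
      note fc = frame_cross[OF fr]
      \<comment> \<open>Multiplication by i sends \<open>X\<close> to \<open>- Phi e3 X\<close> and
        \<open>Phi e1 X\<close> to \<open>Phi e2 X\<close>; the minus sign makes the bracket complex
        bilinear. The normal \<open>n\<close> to the image of \<open>w\<close> spans the abelian
        factor.\<close>
      define g where "g x = Xi (Re (x$3) *\<^sub>R w e1 + Im (x$3) *\<^sub>R w e2) + (Re (x$1) *\<^sub>R X +
          Phi (Re (x$2) *\<^sub>R e1 + Im (x$2) *\<^sub>R e2 - Im (x$1) *\<^sub>R e3) X)" for x :: "complex^3"
      have "lie_isomorphic br (prod_bracket heis3_C_bracket (abelian_bracket :: real \<Rightarrow> _))"
      proof (rule lie_isomorphic_prodI[OF lie, of g "\<lambda>t. Xi (t *\<^sub>R n)"])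
        show "linear g" "linear (\<lambda>t. Xi (t *\<^sub>R n))"
          by (rule linearI; simp add: g_def lin_XP algebra_simps)+
        show "g (heis3_C_bracket x y) = br (g x) (g y)" for x y
        proof -
          have "br (g x) (g y) = Xi (Re (x$1 * y$2 - x$2 * y$1) *\<^sub>R w e1 + Im (x$1 * y$2 - x$2 * y$1) *\<^sub>R w e2)"
            unfolding g_def HB
            by (simp add: cross_add_left cross_add_right cross_mult_left cross_mult_right
                Cross3.left_diff_distrib Cross3.right_diff_distrib fc lw' e3 algebra_simps)
          then show ?thesis
            by (simp add: g_def heis3_C_bracket_def table_bracket_simps axis_def lin_XP algebra_simps)
        qed
        show "Xi (abelian_bracket x y *\<^sub>R n) = br (Xi (x *\<^sub>R n)) (Xi (y *\<^sub>R n))" for x y :: real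
          by (simp only: abelian_bracket_def XX) (simp add: lin_XP)
        show "br (g x) (Xi (y *\<^sub>R n)) = 0" for x y unfolding g_def by (rule HB0)
        show "\<exists>x y. Y = g x + Xi (y *\<^sub>R n)" for Y
        proof -
          obtain x t c where Y: "Y = Xi x + t *\<^sub>R X + Phi c X" using coordsE[OF X] .
          obtain r s q where x: "x = r *\<^sub>R w e1 + s *\<^sub>R w e2 + q *\<^sub>R n"
            using cross_span[of "w e1" "w e2" x] \<open>n \<noteq> 0\<close> unfolding n_def by blast
          define z :: "complex^3" where "z = axis 1 (Complex t (- (c \<bullet> e3)))
              + axis 2 (Complex (c \<bullet> e1) (c \<bullet> e2)) + axis 3 (Complex r s)"
          have c: "Phi c X = (c \<bullet> e1) *\<^sub>R Phi e1 X + (c \<bullet> e2) *\<^sub>R Phi e2 X + (c \<bullet> e3) *\<^sub>R Phi e3 X"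
            by (subst frame_expand[OF fr, of c]) (simp only: lin_XP)
          have "Y = g z + Xi (q *\<^sub>R n)"
            unfolding Y c x by (simp add: g_def z_def axis_def lin_XP)
          then show ?thesis by blast
        qed
      qed (simp add: dim7)
      then show ?thesis by blast
    qed
  qed
qed

end

theorem theorem5p4:
  fixes br :: "'a::real_vector \<Rightarrow> 'a \<Rightarrow> 'a"
    and \<phi> :: "3 \<Rightarrow> 'a \<Rightarrow> 'a" and \<xi> :: "3 \<Rightarrow> 'a" and \<eta> :: "3 \<Rightarrow> 'a \<Rightarrow> real"
  assumes "lie_algebra br"
    and "dim (UNIV :: 'a set) = 7"
    and "\<exists>x y. br x y \<noteq> 0"
    and "abelian_almost_3_contact br \<phi> \<xi> \<eta>"
  shows
    "(bij_betw (assoc_psi br \<phi> \<xi>) (horizontal \<eta>) (horizontal \<eta>) \<or>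
      (\<forall>X\<in>horizontal \<eta>. assoc_psi br \<phi> \<xi> X = 0)) \<and>
     (bij_betw (assoc_psi br \<phi> \<xi>) (horizontal \<eta>) (horizontal \<eta>) \<longrightarrow>
        (\<exists>\<rho> f. lie_action so3_bracket (abelian_bracket :: real^4 \<Rightarrow> _) \<rho> \<and>
               lie_iso_map br (semidirect_bracket so3_bracket abelian_bracket \<rho>) f \<and>
               f ` vertical \<xi> = UNIV \<times> {0} \<and> f ` horizontal \<eta> = {0} \<times> UNIV) \<and>
        (\<exists>\<delta>::real. \<delta> \<noteq> 0 \<and>
           (\<forall>i j k. even_perm3 i j k \<longrightarrow> br (\<xi> i) (\<xi> j) = (2 * \<delta>) *\<^sub>R \<xi> k) \<and>
           (\<forall>i. \<forall>X\<in>horizontal \<eta>. br (\<xi> i) X = \<delta> *\<^sub>R \<phi> i X) \<and>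
           (\<forall>X\<in>horizontal \<eta>. \<forall>Y\<in>horizontal \<eta>. br X Y = 0))) \<and>
     ((\<forall>X\<in>horizontal \<eta>. assoc_psi br \<phi> \<xi> X = 0) \<and> assoc_Z br \<phi> \<xi> = 0 \<longrightarrow>
        lie_isomorphic br (prod_bracket (abelian_bracket :: real^3 \<Rightarrow> _) aff_C_bracket) \<or>
        lie_isomorphic br (prod_bracket heis5_bracket (abelian_bracket :: real^2 \<Rightarrow> _)) \<or>
        lie_isomorphic br (prod_bracket heis3_C_bracket (abelian_bracket :: real \<Rightarrow> _)) \<or>
        lie_isomorphic br heis7_H_bracket \<or>
        lie_isomorphic br (prod_bracket so3_bracket (abelian_bracket :: real^4 \<Rightarrow> _)) \<or>
        lie_isomorphic br (prod_bracket so3_bracket aff_C_bracket)) \<and>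
     ((\<forall>X\<in>horizontal \<eta>. assoc_psi br \<phi> \<xi> X = 0) \<and> assoc_Z br \<phi> \<xi> \<noteq> 0 \<longrightarrow>
        lie_isomorphic br (prod_bracket so3_bracket (abelian_bracket :: real^4 \<Rightarrow> _)) \<or>
        lie_isomorphic br (prod_bracket free_nil2_bracket (abelian_bracket :: real \<Rightarrow> _)))"
    (is "?alt \<and> (?inv \<longrightarrow> ?iso \<and> ?brackets) \<and> (?zero \<and> ?Z0 \<longrightarrow> ?b) \<and> (?zero \<and> ?Z1 \<longrightarrow> ?c)")
proof -
  interpret abelian_3_contact_7 br \<phi> \<xi> \<eta>
    using assms by unfold_locales auto
  have a: "?brackets" if b: ?inv
    using invertible_delta[OF b] invertible_H_abelian[OF b]
    by (intro exI[of _ \<delta>]) (auto simp: br_xi_xi br_xi_H invertible_Z[OF b] invertible_psi[OF b] lin)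
  have b: ?b if z: ?zero ?Z0
  proof -
    interpret psi_Z_zero br \<phi> \<xi> \<eta> using z by unfold_locales auto
    show ?thesis
    \<comment> \<open>A horizontal bracket outside the vertical space leads to aff(C); otherwise
      \<delta> separates so(3) from the nilpotent algebras.\<close>
    proof (cases "\<forall>X\<in>H. \<forall>Y\<in>H. br X Y \<in> range Xi")
      case True
      then show ?thesis
        using vertical_bracket_so3 nilpotent_cases[OF _ _ assms(3)] by (cases "\<delta> = 0") blast+
    next
      case False
      then obtain X Y where "X \<in> H" "Y \<in> H" "br X Y \<notin> range Xi" by blast
      then show ?thesis
        using nonvertical_frame aff_C_factor by metis
    qed
  qed
  have c: ?c if z: ?zero ?Z1
  proof -
    interpret psi_zero br \<phi> \<xi> \<eta> using z by unfold_locales auto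
    show ?thesis
      using so3_times_abelian[OF Z_nonzero_H_abelian] Z_nonzero_nilpotent z(2) by blast
  qed
  show ?thesis using psi_zero_or_bij invertible_iso a b c by blast
qed

end
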